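(* In the setting described in the context (Markov trials, $K$ risky assets), with calibrating functions satisfying (q-p), the following assertions hold. (a) Take any sequence $\{\underline C_j,\ j\ge0\}$ obeying (a0)–(a3). Then $\{S_n-A_n,\ n\ge1\}$ is a supermartingale with respect to $(\mathfrak W_n)$; hence $\mathbb E S_n\le\mathbb E A_n$ for all $n\ge1$. (b) To reach equality $\mathbb E S_n=\sum_{j=1}^n\mathbb E\,\alpha_{j-1}(\varepsilon_{j-1})$: the sequence $\{S_n-A_n\}$ is a martingale for a sequence of random vectors $\{\underline C_j\}$ satisfying (a0)–(a3) if and only if the following (i) and (ii) are fulfilled. (i) There exists a map $i\in M\mapsto\underline D(i)=(D^{(1)}(i),\dots,D^{(K)}(i))$ such that for all $i,k\in M$: (i1) $\underline D(i)\ge\underline 0$ and $|\underline D(i)|<1$; (i2) $1+\underline D(i)\cdot\underline g(i,k)\ge b$; (i3) $\sum_{l\in M}\varphi(i,l)p(i,l)\frac{\underline D(i)\cdot\underline g(i,l)}{1+\underline D(i)\cdot\underline g(i,l)}=0$; and (i4) the calibrating functions are $q_j(i,k)=\frac{p(i,k)}{1+\underline D(i)\cdot\underline g(i,k)}$, independently of $j\ge0$. (ii) The portfolio vectors $\underline C_j$ have components $C^{(s)}_j(\boldsymbol\varepsilon_0^j)=D^{(s)}(\varepsilon_j)Z_j$, $1\le s\le K$, $j\ge0$. That is, the prescribed fractions of the capital value $Z_j$ are invested in the available returns. (c) Suppose there exists a map $i\in M\mapsto\underline D(i)=(D^{(1)}(i),\dots,D^{(K)}(i))$ fulfilling (i1)–(i3).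 Let $\mathbf D$ stand for the array of values $D^{(s)}(i)$, $i\in M$, $1\le s\le K$, and define $$E_n=E_n(\mathbf D)=\sum_{j=1}^n\beta_{j-1},\qquad\beta_{j-1}=\mathbb E\Big\{\varphi(\varepsilon_{j-1},\varepsilon_j)\ln\big[1+\underline D(\varepsilon_{j-1})\cdot\underline g(\varepsilon_{j-1},\varepsilon_j)\big]\Big\}.$$ Consider the optimization problem: maximise $E_n(\mathbf D)$ subject to (i1)–(i3). Let $\mathbf D^*$ be a (possibly non-unique) optimizer and $E_n^*=E_n(\mathbf D^* )$ the optimal value. Then $E^*_n$ defines the maximum of $\mathbb E S_n$ among all portfolios $\{\underline C_j\}$ satisfying (a0)–(a3). The optimizer $\mathbf D^*$, written as a collection of vectors $\underline D^*(i)$, $i\in M$, yields a proportional investment portfolio with $\underline C_j(\boldsymbol\varepsilon_0^j)=\underline D^*(\varepsilon_j)Z_j(\boldsymbol\varepsilon_0^j)$. (d) Suppose there exists a map $i\in M\mapsto\underline D^*(i)$ fulfilling, in the role of $\underline D$, conditions (i1), (i2) and (i3A) $\sum_{l\in M}p(i,l)\frac{\varphi(i,l)g^{(s)}(i,l)}{1+\underline D^*(i)\cdot\underline g(i,l)}=0$ for all $i\in M$ and $1\le s\le K$. Then such a map is unique, and the proportional investment portfolio $\underline C^{O}_{j-1}=\underline D^*(\varepsilon_{j-1})Z_{j-1}$ maximises each summand $\beta_{j-1}$ in the expression for $E_n$ in (c). Therefore, it yields the maximum of the whole sum $\mathbb E S_n$ among strategies satisfying (a0)–(a2).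
   Context: Let $(\varepsilon_n)_{n\ge0}$ be a Markov chain with finite or countable state space $M$ and transition matrix $(p(i,k))_{i,k\in M}$; write $\boldsymbol\varepsilon_0^n=(\varepsilon_0,\dots,\varepsilon_n)$. Let $Z_0>0$ be a random variable (initial capital, possibly dependent on $\varepsilon_0$), $\mathfrak W_0=\sigma(Z_0,\varepsilon_0)$ and $\mathfrak W_n=\mathfrak W_0\vee\sigma(\boldsymbol\varepsilon_0^n)$; the chain is Markov relative to $(\mathfrak W_n)$, i.e. the conditional law of $\varepsilon_n$ given $\mathfrak W_{n-1}$ is $p(\varepsilon_{n-1},\cdot)$. There are $K$ risky assets with return functions $g^{(s)}:M\times M\to\mathbb R$, $1\le s\le K$, and $\underline g=(g^{(1)},\dots,g^{(K)})$. The weight function is $\varphi:M\times M\to[0,\infty)$. The functions $\underline g$ and $\varphi$ are not identically $0$. Fix $b>0$. Calibrating functions are given functions $q_j:M\times M\to(0,\infty)$. For $\underline u=(u^{(1)},\dots,u^{(K)})$: $|\underline u|=\sum_{s=1}^Ku^{(s)}$; $\underline u\ge\underline0$ means $u^{(s)}\ge0$ for all $s$; $\underline u\cdot\underline v=\sum_su^{(s)}v^{(s)}$. A strategy (portfolio) is a sequence of random $K$-vectors $\underline C_0,\underline C_1,\dots$; the capital evolves by $$Z_n=Z_{n-1}+\underline C_{n-1}\cdot\underline g(\varepsilon_{n-1},\varepsilon_n)=Z_{n-1}\Big[1+\frac{\underline C_{n-1}\cdot\underline g(\varepsilon_{n-1},\varepsilon_n)}{Z_{n-1}}\Big],\quad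 n\ge1.$$ Define $$S_n=\sum_{j=1}^n\varphi(\varepsilon_{j-1},\varepsilon_j)\ln\frac{Z_j}{Z_{j-1}},\qquad \alpha_{j}(i)=\sum_{l\in M}\varphi(i,l)p(i,l)\ln\frac{p(i,l)}{q_{j+1}(i,l)},\qquad A_n=\sum_{j=1}^n\alpha_{j-1}(\varepsilon_{j-1}).$$ All series and expectations involved are assumed to converge absolutely. Conditions on a strategy (for all $j\ge0$): (a0) $\underline C_j$ is $\mathfrak W_j$-measurable; (a1) $\underline C_j\ge\underline0$ and $|\underline C_j|<Z_j$; (a2) $1+\frac{\underline C_j\cdot\underline g(\varepsilon_j,\varepsilon_{j+1})}{Z_j}\ge b$; (a3) $\sum_{l\in M}\varphi(\varepsilon_j,l)q_{j+1}(\varepsilon_j,l)\big[\underline C_j\cdot\underline g(\varepsilon_j,l)\big]=0$. Condition on the calibrating functions: (q-p) for all $i\in M$ and all $j\ge0$: $\sum_{l\in M}\varphi(i,l)[q_j(i,l)-p(i,l)]\le0$.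
   Formalization: (a2) in (a),(b) is required for every next state; (super)martingales start at n=0; (b) holds literally for φ>0, constant q_j, all states visited, nondegenerate g, else with D_j(i) up to unseen returns; (c) takes q from (i4); (d) D* is unique where g is nondegenerate, else up to returns. *)

theory Defs
  imports "HOL-Probability.Probability"
begin

text \<open>
  The state space is a countable type \<open>'m\<close> (finite types included) and the \<open>K\<close> assets are
  indexed by a finite type \<open>'k\<close>, so portfolios and returns are vectors in \<open>real ^ 'k\<close>.
  Random conditions on strategies are required almost surely. Absolutely convergent series over
  the state space are expressed by \<open>has_sum\<close> and \<open>summable_on\<close>, which for real-valued
  families mean absolute convergence.
\<close>

section \<open>Martingales in discrete time\<close>

definition filtration_on :: "'w measure \<Rightarrow> (nat \<Rightarrow> 'w measure) \<Rightarrow> bool" where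
  "filtration_on P F \<longleftrightarrow>
     (\<forall>n. subalgebra P (F n)) \<and> (\<forall>m n. m \<le> n \<longrightarrow> sets (F m) \<subseteq> sets (F n))"

definition supermartingale ::
    "'w measure \<Rightarrow> (nat \<Rightarrow> 'w measure) \<Rightarrow> (nat \<Rightarrow> 'w \<Rightarrow> real) \<Rightarrow> bool" where
  "supermartingale P F X \<longleftrightarrow> filtration_on P F \<and>
     (\<forall>n. X n \<in> borel_measurable (F n) \<and> integrable P (X n)) \<and>
     (\<forall>m n. m \<le> n \<longrightarrow> (AE \<omega> in P. real_cond_exp P (F m) (X n) \<omega> \<le> X m \<omega>))"

definition martingale ::
    "'w measure \<Rightarrow> (nat \<Rightarrow> 'w measure) \<Rightarrow> (nat \<Rightarrow> 'w \<Rightarrow> real) \<Rightarrow> bool" where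
  "martingale P F X \<longleftrightarrow> filtration_on P F \<and>
     (\<forall>n. X n \<in> borel_measurable (F n) \<and> integrable P (X n)) \<and>
     (\<forall>m n. m \<le> n \<longrightarrow> (AE \<omega> in P. real_cond_exp P (F m) (X n) \<omega> = X m \<omega>))"

section \<open>Markov trials\<close>

definition info :: "'w measure \<Rightarrow> ('w \<Rightarrow> real) \<Rightarrow> (nat \<Rightarrow> 'w \<Rightarrow> 'm) \<Rightarrow> nat \<Rightarrow> 'w measure" where
  "info P Z0 eps n = sigma (space P)
     ({Z0 -` B \<inter> space P | B. B \<in> sets borel} \<union>
      {eps k -` B \<inter> space P | k B. k \<le> n})"

locale markov_market = prob_space P
  for P :: "'w measure" +
  fixes Z0 :: "'w \<Rightarrow> real"
    and eps :: "nat \<Rightarrow> 'w \<Rightarrow> 'm :: countable"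
    and p :: "'m \<Rightarrow> 'm \<Rightarrow> real"
    and g :: "'m \<Rightarrow> 'm \<Rightarrow> real ^ 'k"
    and phi :: "'m \<Rightarrow> 'm \<Rightarrow> real"
    and b :: real
  assumes Z0_measurable: "Z0 \<in> borel_measurable P"
    and Z0_pos: "AE \<omega> in P. Z0 \<omega> > 0"
    and eps_measurable: "eps n \<in> measurable P (count_space UNIV)"
    and p_nonneg: "p i k \<ge> 0"
    and p_stochastic: "(p i has_sum 1) UNIV"
    and markov: "AE \<omega> in P.
      real_cond_exp P (info P Z0 eps n) (\<lambda>\<omega>'. indicator {k} (eps (Suc n) \<omega>')) \<omega> = p (eps n \<omega>) k"
    and phi_nonneg: "phi i k \<ge> 0"
    and phi_nonzero: "\<exists>i k. phi i k \<noteq> 0"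
    and g_nonzero: "\<exists>i k. g i k \<noteq> 0"
    and b_pos: "b > 0"

section \<open>Capital, weighted log-growth and its compensator\<close>

primrec capital ::
    "('w \<Rightarrow> real) \<Rightarrow> (nat \<Rightarrow> 'w \<Rightarrow> 'm) \<Rightarrow> ('m \<Rightarrow> 'm \<Rightarrow> real ^ 'k) \<Rightarrow>
     (nat \<Rightarrow> 'w \<Rightarrow> real ^ 'k) \<Rightarrow> nat \<Rightarrow> 'w \<Rightarrow> real" where
  "capital Z0 eps g C 0 \<omega> = Z0 \<omega>"
| "capital Z0 eps g C (Suc n) \<omega> =
     capital Z0 eps g C n \<omega> + C n \<omega> \<bullet> g (eps n \<omega>) (eps (Suc n) \<omega>)"

definition log_growth ::
    "('w \<Rightarrow> real) \<Rightarrow> (nat \<Rightarrow> 'w \<Rightarrow> 'm) \<Rightarrow> ('m \<Rightarrow> 'm \<Rightarrow> real ^ 'k) \<Rightarrow> ('m \<Rightarrow> 'm \<Rightarrow> real) \<Rightarrow>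
     (nat \<Rightarrow> 'w \<Rightarrow> real ^ 'k) \<Rightarrow> nat \<Rightarrow> 'w \<Rightarrow> real" where
  "log_growth Z0 eps g phi C n \<omega> =
     (\<Sum>j=1..n. phi (eps (j - 1) \<omega>) (eps j \<omega>) *
        ln (capital Z0 eps g C j \<omega> / capital Z0 eps g C (j - 1) \<omega>))"

text \<open>Terms with \<open>p i l = 0\<close> contribute \<open>0\<close> to \<open>alpha\<close>, by the usual convention.\<close>

definition alpha ::
    "('m \<Rightarrow> 'm \<Rightarrow> real) \<Rightarrow> ('m \<Rightarrow> 'm \<Rightarrow> real) \<Rightarrow> (nat \<Rightarrow> 'm \<Rightarrow> 'm \<Rightarrow> real) \<Rightarrow>
     nat \<Rightarrow> 'm \<Rightarrow> real" where
  "alpha p phi q j i = (\<Sum>\<^sub>\<infinity>l. phi i l * p i l * ln (p i l / q (Suc j) i l))"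

definition compensator ::
    "(nat \<Rightarrow> 'w \<Rightarrow> 'm) \<Rightarrow> ('m \<Rightarrow> 'm \<Rightarrow> real) \<Rightarrow> ('m \<Rightarrow> 'm \<Rightarrow> real) \<Rightarrow>
     (nat \<Rightarrow> 'm \<Rightarrow> 'm \<Rightarrow> real) \<Rightarrow> nat \<Rightarrow> 'w \<Rightarrow> real" where
  "compensator eps p phi q n \<omega> = (\<Sum>j=1..n. alpha p phi q (j - 1) (eps (j - 1) \<omega>))"

section \<open>Calibrating functions\<close>

definition cond_qp ::
    "('m \<Rightarrow> 'm \<Rightarrow> real) \<Rightarrow> ('m \<Rightarrow> 'm \<Rightarrow> real) \<Rightarrow> (nat \<Rightarrow> 'm \<Rightarrow> 'm \<Rightarrow> real) \<Rightarrow> bool" where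
  "cond_qp p phi q \<longleftrightarrow> (\<forall>j i. (\<lambda>l. phi i l * (q j i l - p i l)) summable_on UNIV \<and>
      (\<Sum>\<^sub>\<infinity>l. phi i l * (q j i l - p i l)) \<le> 0)"

definition calibrating ::
    "'w measure \<Rightarrow> (nat \<Rightarrow> 'w \<Rightarrow> 'm) \<Rightarrow> ('m \<Rightarrow> 'm \<Rightarrow> real) \<Rightarrow> ('m \<Rightarrow> 'm \<Rightarrow> real) \<Rightarrow>
     (nat \<Rightarrow> 'm \<Rightarrow> 'm \<Rightarrow> real) \<Rightarrow> bool" where
  "calibrating P eps p phi q \<longleftrightarrow>
     (\<forall>j i k. q j i k > 0) \<and>
     cond_qp p phi q \<and>
     (\<forall>j i. (\<lambda>l. phi i l * p i l * ln (p i l / q (Suc j) i l)) summable_on UNIV) \<and>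
     (\<forall>j. integrable P (\<lambda>\<omega>. alpha p phi q j (eps j \<omega>)))"

section \<open>Conditions on a strategy\<close>

definition cond_a0 ::
    "'w measure \<Rightarrow> ('w \<Rightarrow> real) \<Rightarrow> (nat \<Rightarrow> 'w \<Rightarrow> 'm) \<Rightarrow> (nat \<Rightarrow> 'w \<Rightarrow> real ^ 'k) \<Rightarrow> bool" where
  "cond_a0 P Z0 eps C \<longleftrightarrow> (\<forall>j. C j \<in> borel_measurable (info P Z0 eps j))"

definition cond_a1 ::
    "'w measure \<Rightarrow> ('w \<Rightarrow> real) \<Rightarrow> (nat \<Rightarrow> 'w \<Rightarrow> 'm) \<Rightarrow> ('m \<Rightarrow> 'm \<Rightarrow> real ^ 'k) \<Rightarrow>
     (nat \<Rightarrow> 'w \<Rightarrow> real ^ 'k) \<Rightarrow> bool" where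
  "cond_a1 P Z0 eps g C \<longleftrightarrow> (\<forall>j. AE \<omega> in P.
     (\<forall>s. C j \<omega> $ s \<ge> 0) \<and> (\<Sum>s\<in>UNIV. C j \<omega> $ s) < capital Z0 eps g C j \<omega>)"

definition cond_a2 ::
    "'w measure \<Rightarrow> ('w \<Rightarrow> real) \<Rightarrow> (nat \<Rightarrow> 'w \<Rightarrow> 'm) \<Rightarrow> ('m \<Rightarrow> 'm \<Rightarrow> real ^ 'k) \<Rightarrow> real \<Rightarrow>
     (nat \<Rightarrow> 'w \<Rightarrow> real ^ 'k) \<Rightarrow> bool" where
  "cond_a2 P Z0 eps g b C \<longleftrightarrow> (\<forall>j. AE \<omega> in P.
     1 + (C j \<omega> \<bullet> g (eps j \<omega>) (eps (Suc j) \<omega>)) / capital Z0 eps g C j \<omega> \<ge> b)"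

text \<open>
  \<open>cond_a2_all\<close> asks for the bound of \<open>cond_a2\<close> at every possible value of the next state rather
  than at the realised one. The two conditions are equivalent if all \<open>p i l\<close> are positive. If
  \<open>p i l = 0\<close> they differ: \<open>cond_a2\<close> then does not restrict the return of the transition from
  \<open>i\<close> to \<open>l\<close>, although this return enters \<open>cond_a3\<close> with the positive weight \<open>q i l\<close>.
\<close>

definition cond_a2_all ::
    "'w measure \<Rightarrow> ('w \<Rightarrow> real) \<Rightarrow> (nat \<Rightarrow> 'w \<Rightarrow> 'm) \<Rightarrow> ('m \<Rightarrow> 'm \<Rightarrow> real ^ 'k) \<Rightarrow> real \<Rightarrow>
     (nat \<Rightarrow> 'w \<Rightarrow> real ^ 'k) \<Rightarrow> bool" where
  "cond_a2_all P Z0 eps g b C \<longleftrightarrow> (\<forall>j. AE \<omega> in P. \<forall>l.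
     1 + (C j \<omega> \<bullet> g (eps j \<omega>) l) / capital Z0 eps g C j \<omega> \<ge> b)"

definition cond_a3 ::
    "'w measure \<Rightarrow> (nat \<Rightarrow> 'w \<Rightarrow> 'm) \<Rightarrow> ('m \<Rightarrow> 'm \<Rightarrow> real ^ 'k) \<Rightarrow> ('m \<Rightarrow> 'm \<Rightarrow> real) \<Rightarrow>
     (nat \<Rightarrow> 'm \<Rightarrow> 'm \<Rightarrow> real) \<Rightarrow> (nat \<Rightarrow> 'w \<Rightarrow> real ^ 'k) \<Rightarrow> bool" where
  "cond_a3 P eps g phi q C \<longleftrightarrow> (\<forall>j. AE \<omega> in P.
     ((\<lambda>l. phi (eps j \<omega>) l * q (Suc j) (eps j \<omega>) l * (C j \<omega> \<bullet> g (eps j \<omega>) l)) has_sum 0) UNIV)"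

definition growth_integrable ::
    "'w measure \<Rightarrow> ('w \<Rightarrow> real) \<Rightarrow> (nat \<Rightarrow> 'w \<Rightarrow> 'm) \<Rightarrow> ('m \<Rightarrow> 'm \<Rightarrow> real ^ 'k) \<Rightarrow>
     ('m \<Rightarrow> 'm \<Rightarrow> real) \<Rightarrow> (nat \<Rightarrow> 'w \<Rightarrow> real ^ 'k) \<Rightarrow> bool" where
  "growth_integrable P Z0 eps g phi C \<longleftrightarrow> (\<forall>n. integrable P (log_growth Z0 eps g phi C n))"

section \<open>Proportional investment\<close>

text \<open>The conditions on a single vector \<open>d = D i\<close> of fractions held in state \<open>i\<close>.\<close>

definition cond_i1 :: "real ^ 'k \<Rightarrow> bool" where
  "cond_i1 d \<longleftrightarrow> (\<forall>s. d $ s \<ge> 0) \<and> (\<Sum>s\<in>UNIV. d $ s) < 1"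

definition cond_i2 :: "('m \<Rightarrow> 'm \<Rightarrow> real ^ 'k) \<Rightarrow> real \<Rightarrow> 'm \<Rightarrow> real ^ 'k \<Rightarrow> bool" where
  "cond_i2 g b i d \<longleftrightarrow> (\<forall>k. 1 + d \<bullet> g i k \<ge> b)"

definition cond_i3 ::
    "('m \<Rightarrow> 'm \<Rightarrow> real) \<Rightarrow> ('m \<Rightarrow> 'm \<Rightarrow> real ^ 'k) \<Rightarrow> ('m \<Rightarrow> 'm \<Rightarrow> real) \<Rightarrow>
     'm \<Rightarrow> real ^ 'k \<Rightarrow> bool" where
  "cond_i3 p g phi i d \<longleftrightarrow>
     ((\<lambda>l. phi i l * p i l * ((d \<bullet> g i l) / (1 + d \<bullet> g i l))) has_sum 0) UNIV"

definition cond_i3A ::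
    "('m \<Rightarrow> 'm \<Rightarrow> real) \<Rightarrow> ('m \<Rightarrow> 'm \<Rightarrow> real ^ 'k) \<Rightarrow> ('m \<Rightarrow> 'm \<Rightarrow> real) \<Rightarrow>
     'm \<Rightarrow> real ^ 'k \<Rightarrow> bool" where
  "cond_i3A p g phi i d \<longleftrightarrow> (\<forall>s.
     ((\<lambda>l. p i l * ((phi i l * g i l $ s) / (1 + d \<bullet> g i l))) has_sum 0) UNIV)"

definition cond_i4 ::
    "('m \<Rightarrow> 'm \<Rightarrow> real) \<Rightarrow> ('m \<Rightarrow> 'm \<Rightarrow> real ^ 'k) \<Rightarrow> (nat \<Rightarrow> 'm \<Rightarrow> 'm \<Rightarrow> real) \<Rightarrow>
     ('m \<Rightarrow> real ^ 'k) \<Rightarrow> bool" where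
  "cond_i4 p g q D \<longleftrightarrow> (\<forall>j i k. q j i k = p i k / (1 + D i \<bullet> g i k))"

definition cond_ii ::
    "'w measure \<Rightarrow> ('w \<Rightarrow> real) \<Rightarrow> (nat \<Rightarrow> 'w \<Rightarrow> 'm) \<Rightarrow> ('m \<Rightarrow> 'm \<Rightarrow> real ^ 'k) \<Rightarrow>
     ('m \<Rightarrow> real ^ 'k) \<Rightarrow> (nat \<Rightarrow> 'w \<Rightarrow> real ^ 'k) \<Rightarrow> bool" where
  "cond_ii P Z0 eps g D C \<longleftrightarrow> (\<forall>j. AE \<omega> in P. \<forall>s.
     C j \<omega> $ s = D (eps j \<omega>) $ s * capital Z0 eps g C j \<omega>)"

text \<open>No nonzero combination of the assets has zero return on all transitions from \<open>i\<close> that have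
  positive weight and positive probability.\<close>

definition nondegenerate ::
    "('m \<Rightarrow> 'm \<Rightarrow> real) \<Rightarrow> ('m \<Rightarrow> 'm \<Rightarrow> real ^ 'k) \<Rightarrow> ('m \<Rightarrow> 'm \<Rightarrow> real) \<Rightarrow> 'm \<Rightarrow> bool" where
  "nondegenerate p g phi i \<longleftrightarrow>
     (\<forall>v. (\<forall>k. phi i k * p i k > 0 \<longrightarrow> v \<bullet> g i k = 0) \<longrightarrow> v = 0)"

definition prop_increment ::
    "(nat \<Rightarrow> 'w \<Rightarrow> 'm) \<Rightarrow> ('m \<Rightarrow> 'm \<Rightarrow> real ^ 'k) \<Rightarrow> ('m \<Rightarrow> 'm \<Rightarrow> real) \<Rightarrow>
     ('m \<Rightarrow> real ^ 'k) \<Rightarrow> nat \<Rightarrow> 'w \<Rightarrow> real" where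
  "prop_increment eps g phi D j \<omega> = phi (eps j \<omega>) (eps (Suc j) \<omega>) *
     ln (1 + D (eps j \<omega>) \<bullet> g (eps j \<omega>) (eps (Suc j) \<omega>))"

definition beta ::
    "'w measure \<Rightarrow> (nat \<Rightarrow> 'w \<Rightarrow> 'm) \<Rightarrow> ('m \<Rightarrow> 'm \<Rightarrow> real ^ 'k) \<Rightarrow> ('m \<Rightarrow> 'm \<Rightarrow> real) \<Rightarrow>
     ('m \<Rightarrow> real ^ 'k) \<Rightarrow> nat \<Rightarrow> real" where
  "beta P eps g phi D j = (\<integral>\<omega>. prop_increment eps g phi D j \<omega> \<partial>P)"

definition prop_growth ::
    "'w measure \<Rightarrow> (nat \<Rightarrow> 'w \<Rightarrow> 'm) \<Rightarrow> ('m \<Rightarrow> 'm \<Rightarrow> real ^ 'k) \<Rightarrow> ('m \<Rightarrow> 'm \<Rightarrow> real) \<Rightarrow>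
     ('m \<Rightarrow> real ^ 'k) \<Rightarrow> nat \<Rightarrow> real" where
  "prop_growth P eps g phi D n = (\<Sum>j=1..n. beta P eps g phi D (j - 1))"

text \<open>The maps admitted in the optimization problem: those fulfilling \<open>cond_i1\<close>--\<open>cond_i3\<close> for which the
  expectations in the objective exist.\<close>

definition feasible ::
    "'w measure \<Rightarrow> (nat \<Rightarrow> 'w \<Rightarrow> 'm) \<Rightarrow> ('m \<Rightarrow> 'm \<Rightarrow> real) \<Rightarrow> ('m \<Rightarrow> 'm \<Rightarrow> real ^ 'k) \<Rightarrow>
     ('m \<Rightarrow> 'm \<Rightarrow> real) \<Rightarrow> real \<Rightarrow> ('m \<Rightarrow> real ^ 'k) \<Rightarrow> bool" where
  "feasible P eps p g phi b D \<longleftrightarrow>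
     (\<forall>i. cond_i1 (D i) \<and> cond_i2 g b i (D i) \<and> cond_i3 p g phi i (D i)) \<and>
     (\<forall>j. integrable P (prop_increment eps g phi D j))"

definition optimizer ::
    "'w measure \<Rightarrow> (nat \<Rightarrow> 'w \<Rightarrow> 'm) \<Rightarrow> ('m \<Rightarrow> 'm \<Rightarrow> real) \<Rightarrow> ('m \<Rightarrow> 'm \<Rightarrow> real ^ 'k) \<Rightarrow>
     ('m \<Rightarrow> 'm \<Rightarrow> real) \<Rightarrow> real \<Rightarrow> nat \<Rightarrow> ('m \<Rightarrow> real ^ 'k) \<Rightarrow> bool" where
  "optimizer P eps p g phi b n D \<longleftrightarrow> feasible P eps p g phi b D \<and>
     (\<forall>D'. feasible P eps p g phi b D' \<longrightarrow>
        prop_growth P eps g phi D' n \<le> prop_growth P eps g phi D n)"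

end

theory Submission
  imports Defs
begin

text \<open>
  Fix the present state \<open>i\<close> and write \<open>R l\<close> for the ratio of successive capitals if the next state
  is \<open>l\<close>. By the Markov property the conditional mean of the weighted log-growth over one period
  is \<open>\<Sum>l. phi i l * p i l * ln (R l)\<close> (lemma \<open>cond_exp_next_state\<close>; the ratio depends on the past,
  but for every fixed \<open>l\<close> it is known at the present time). Since \<open>ln x \<le> x - 1\<close>, applied at
  \<open>x = q i l * R l / p i l\<close>, this mean is at most

    \<open>(\<Sum>l. phi i l * p i l * ln (p i l / q i l)) + (\<Sum>l. phi i l * (q i l * R l - p i l))\<close>

  (lemma \<open>weighted_log_sum_inequality\<close>). The first sum is the compensator increment. Because
  \<open>R l - 1\<close> is the return divided by the present capital, the second sum is the sum of
  \<open>phi * (q - p)\<close>, which is nonpositive by calibration, and a multiple of the weighted \<open>q\<close>-mean of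
  the return, which vanishes by \<open>cond_a3\<close>. Hence log-growth minus compensator is a
  supermartingale. Equality in \<open>ln x \<le> x - 1\<close> forces \<open>q i l * R l = p i l\<close> wherever the weight is
  positive, that is, \<open>q i l = p i l / (1 + d \<bullet> g i l)\<close> for the vector \<open>d\<close> of invested fractions; so the
  martingale property fixes these fractions as far as they affect the returns seen by the weight.

  Read backwards, the same inequality compares strategies. For \<open>q i l = p i l / (1 + D i \<bullet> g i l)\<close>
  the first sum is the mean log-growth of the proportional portfolio with fractions \<open>D\<close>, so
  \<open>D\<close> does at least as well as any strategy for which the second sum vanishes in every period
  (lemma \<open>expectation_le_beta\<close>). If the strategy satisfies \<open>cond_a3\<close> for this \<open>q\<close>, the second
  sum vanishes by \<open>cond_a3\<close> and \<open>cond_i3\<close>. If \<open>D\<close> satisfies the assetwise condition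
  \<open>cond_i3A\<close>, which says that the gradient of the concave mean log-growth is zero, the sum
  vanishes for all strategies; by strict concavity the condition determines the returns of \<open>D\<close>
  on all transitions of positive weight and probability.
\<close>

section \<open>A weighted Gibbs inequality\<close>

text \<open>
  This is \<open>ln x \<le> x - 1\<close> at \<open>x = q l * R l / p l\<close>, multiplied by \<open>f l * p l\<close> and summed. The
  difference of the two sides is a sum of nonnegative terms, so equality holds only termwise, where
  \<open>ln x = x - 1\<close> forces \<open>x = 1\<close>. Indices with \<open>p l = 0\<close> enter only through \<open>f l * q l * R l\<close>, which
  is why \<open>q l * R l\<close> must be nonnegative there.
\<close>

lemma weighted_log_sum_inequality:
  fixes f p q R :: "'a \<Rightarrow> real"
  assumes f: "\<And>l. 0 \<le> f l" and p: "\<And>l. 0 \<le> p l"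
    and pos: "\<And>l. 0 < p l \<Longrightarrow> 0 < q l \<and> 0 < R l"
    and qR: "\<And>l. 0 \<le> q l * R l"
    and s: "((\<lambda>l. f l * p l * ln (R l)) has_sum s) A"
    and a: "((\<lambda>l. f l * p l * ln (p l / q l)) has_sum a) A"
    and c: "((\<lambda>l. f l * (q l * R l - p l)) has_sum c) A" "c \<le> 0"
  shows "s \<le> a" and "s = a \<longleftrightarrow> (\<forall>l\<in>A. 0 < f l \<longrightarrow> q l * R l = p l)"
proof -
  define u where "u l = f l * (q l * R l - p l) - (f l * p l * ln (R l) - f l * p l * ln (p l / q l))" for l
  have u: "0 \<le> u l" "u l = 0 \<Longrightarrow> 0 < f l \<Longrightarrow> q l * R l = p l" for l
  proof -
    have *: "0 \<le> u l \<and> (u l = 0 \<longrightarrow> 0 < f l \<longrightarrow> q l * R l = p l)"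
    proof (cases "p l = 0")
      case True
      then show ?thesis using f[of l] qR[of l] by (auto simp: u_def)
    next
      case False
      with p[of l] have pl: "0 < p l" by simp
      with pos[of l] have ql: "0 < q l" and Rl: "0 < R l" by auto
      define x where "x = q l * R l / p l"
      have x: "0 < x" using pl ql Rl by (simp add: x_def)
      have "ln (R l) - ln (p l / q l) = ln x"
        using pl ql Rl by (simp add: x_def ln_div ln_mult)
      then have ul: "u l = f l * p l * (x - 1 - ln x)"
        using pl by (simp add: u_def x_def field_simps)
      have "ln x \<le> x - 1" using x by (rule ln_le_minus_one)
      moreover have "q l * R l = p l" if "x - 1 - ln x = 0"
        using ln_eq_minus_one[OF x] that pl by (simp add: x_def)
      ultimately show ?thesis using f[of l] pl by (auto simp: ul)
    qed
    show "0 \<le> u l" "u l = 0 \<Longrightarrow> 0 < f l \<Longrightarrow> q l * R l = p l" using * by auto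
  qed
  have us: "(u has_sum (c - (s - a))) A"
    unfolding u_def
    using has_sum_add[OF c(1) has_sum_uminusI[OF has_sum_add[OF s has_sum_uminusI[OF a]]]]
    by (simp add: algebra_simps)
  have "0 \<le> c - (s - a)" using us u(1) by (rule has_sum_nonneg)
  with c(2) show "s \<le> a" by simp
  show "s = a \<longleftrightarrow> (\<forall>l\<in>A. 0 < f l \<longrightarrow> q l * R l = p l)"
  proof
    assume "s = a"
    then have "c - (s - a) \<le> 0" using c(2) by simp
    then show "\<forall>l\<in>A. 0 < f l \<longrightarrow> q l * R l = p l"
      using nonneg_has_sum_le_0D[OF us] u by blast
  next
    assume eq: "\<forall>l\<in>A. 0 < f l \<longrightarrow> q l * R l = p l"
    have terms: "f l * p l * ln (R l) = f l * p l * ln (p l / q l)" if "l \<in> A" for l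
    proof (cases "0 < f l \<and> 0 < p l")
      case True
      with pos[of l] eq that have "R l = p l / q l" by (auto simp: field_simps)
      then show ?thesis by simp
    next
      case False
      with f[of l] p[of l] have "f l * p l = 0" by auto
      then show ?thesis by simp
    qed
    have "((\<lambda>l. f l * p l * ln (R l)) has_sum a) A"
      using a terms by (subst has_sum_cong[OF terms])
    with s show "s = a" by (rule has_sum_unique)
  qed
qed

lemma has_sum_finite_sum:
  fixes h :: "'s \<Rightarrow> 'l \<Rightarrow> real"
  assumes "finite S" and "\<And>s. s \<in> S \<Longrightarrow> (h s has_sum a s) A"
  shows "((\<lambda>l. \<Sum>s\<in>S. h s l) has_sum (\<Sum>s\<in>S. a s)) A"
  using assms by (induction S rule: finite_induct) (auto intro: has_sum_add)

section \<open>Supermartingales from one-step inequalities\<close>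

lemma filtration_onD:
  assumes "filtration_on M F"
  shows "subalgebra M (F n)" and "m \<le> n \<Longrightarrow> subalgebra (F n) (F m)"
  using assms unfolding filtration_on_def subalgebra_def by auto

lemma (in prob_space) sigma_finite_subalgebraI:
  "subalgebra M F \<Longrightarrow> sigma_finite_subalgebra M F"
proof -
  assume "subalgebra M F"
  then interpret finite_measure_subalgebra M F
    by unfold_locales
  show ?thesis by unfold_locales
qed

text \<open>
  By the tower property, conditioning on an earlier \<open>F m\<close> factors through \<open>F n\<close>, so the one-step
  inequalities can be chained.
\<close>

lemma (in prob_space) supermartingale_stepI:
  assumes F: "filtration_on M F"
    and X: "\<And>n. X n \<in> borel_measurable (F n)" "\<And>n. integrable M (X n)"
    and step: "\<And>n. AE \<omega> in M. real_cond_exp M (F n) (X (Suc n)) \<omega> \<le> X n \<omega>"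
  shows "supermartingale M F X"
  unfolding supermartingale_def
proof (intro conjI allI impI F X)
  fix m n :: nat
  assume "m \<le> n"
  interpret m: sigma_finite_subalgebra M "F m"
    by (rule sigma_finite_subalgebraI[OF filtration_onD(1)[OF F]])
  show "AE \<omega> in M. real_cond_exp M (F m) (X n) \<omega> \<le> X m \<omega>"
    using \<open>m \<le> n\<close>
  proof (induction n rule: dec_induct)
    case base
    show ?case using m.real_cond_exp_F_meas[OF X(2) X(1)] by auto
  next
    case (step n)
    interpret n: sigma_finite_subalgebra M "F n"
      by (rule sigma_finite_subalgebraI[OF filtration_onD(1)[OF F]])
    have "AE \<omega> in M. real_cond_exp M (F m) (real_cond_exp M (F n) (X (Suc n))) \<omega>
        = real_cond_exp M (F m) (X (Suc n)) \<omega>"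
      using step.hyps by (intro m.real_cond_exp_nested_subalg filtration_onD[OF F] X) auto
    moreover have "AE \<omega> in M. real_cond_exp M (F m) (real_cond_exp M (F n) (X (Suc n))) \<omega>
        \<le> real_cond_exp M (F m) (X n) \<omega>"
      by (intro m.real_cond_exp_mono assms(4) n.real_cond_exp_int X)
    ultimately show ?case using step.IH by eventually_elim simp
  qed
qed

lemma (in prob_space) AE_eq_of_le_of_integral_eq:
  fixes f h :: "'a \<Rightarrow> real"
  assumes "integrable M f" "integrable M h" "AE \<omega> in M. f \<omega> \<le> h \<omega>"
    and "(\<integral>\<omega>. f \<omega> \<partial>M) = (\<integral>\<omega>. h \<omega> \<partial>M)"
  shows "AE \<omega> in M. f \<omega> = h \<omega>"
proof -
  have "(\<integral>\<omega>. h \<omega> - f \<omega> \<partial>M) = 0" using assms by simp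
  then have "AE \<omega> in M. h \<omega> - f \<omega> = 0"
    using assms by (subst (asm) integral_nonneg_eq_0_iff_AE) auto
  then show ?thesis by eventually_elim simp
qed

text \<open>
  For a supermartingale the conditional expectation lies below the earlier value; equal
  expectations leave no room between the two.
\<close>

lemma (in prob_space) martingale_iff_constant_expectation:
  assumes "supermartingale M F X"
  shows "martingale M F X \<longleftrightarrow> (\<forall>n. (\<integral>\<omega>. X n \<omega> \<partial>M) = (\<integral>\<omega>. X 0 \<omega> \<partial>M))"
proof -
  have F: "filtration_on M F" and Xm: "X n \<in> borel_measurable (F n)" and Xi: "integrable M (X n)"
    and le: "m \<le> n \<Longrightarrow> AE \<omega> in M. real_cond_exp M (F m) (X n) \<omega> \<le> X m \<omega>" for m n
    using assms by (auto simp: supermartingale_def)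
  interpret sub: sigma_finite_subalgebra M "F m" for m
    by (rule sigma_finite_subalgebraI[OF filtration_onD(1)[OF F]])
  have ce: "integrable M (real_cond_exp M (F m) (X n))"
    "(\<integral>\<omega>. real_cond_exp M (F m) (X n) \<omega> \<partial>M) = (\<integral>\<omega>. X n \<omega> \<partial>M)" for m n
    using sub.real_cond_exp_int[OF Xi] by auto
  show ?thesis
  proof
    assume "martingale M F X"
    then have "AE \<omega> in M. real_cond_exp M (F 0) (X n) \<omega> = X 0 \<omega>" for n
      by (simp add: martingale_def)
    then show "\<forall>n. (\<integral>\<omega>. X n \<omega> \<partial>M) = (\<integral>\<omega>. X 0 \<omega> \<partial>M)"
      using ce(2)[of 0] integral_cong_AE[OF borel_measurable_integrable[OF ce(1)]
          borel_measurable_integrable[OF Xi]] by metis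
  next
    assume eq: "\<forall>n. (\<integral>\<omega>. X n \<omega> \<partial>M) = (\<integral>\<omega>. X 0 \<omega> \<partial>M)"
    have "AE \<omega> in M. real_cond_exp M (F m) (X n) \<omega> = X m \<omega>" if "m \<le> n" for m n
      by (rule AE_eq_of_le_of_integral_eq[OF ce(1) Xi le[OF that]]) (metis ce(2) eq)
    then show "martingale M F X" using F Xm Xi by (simp add: martingale_def)
  qed
qed

lemma (in prob_space) martingale_stepI:
  assumes F: "filtration_on M F"
    and X: "\<And>n. X n \<in> borel_measurable (F n)" "\<And>n. integrable M (X n)"
    and step: "\<And>n. AE \<omega> in M. real_cond_exp M (F n) (X (Suc n)) \<omega> = X n \<omega>"
  shows "martingale M F X"
proof -
  have "AE \<omega> in M. real_cond_exp M (F n) (X (Suc n)) \<omega> \<le> X n \<omega>" for n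
    using step[of n] by eventually_elim simp
  then have "supermartingale M F X"
    by (intro supermartingale_stepI[OF F X])
  moreover have "(\<integral>\<omega>. X n \<omega> \<partial>M) = (\<integral>\<omega>. X 0 \<omega> \<partial>M)" for n
  proof (induction n)
    case (Suc n)
    interpret sigma_finite_subalgebra M "F n"
      by (rule sigma_finite_subalgebraI[OF filtration_onD(1)[OF F]])
    have "(\<integral>\<omega>. X (Suc n) \<omega> \<partial>M) = (\<integral>\<omega>. real_cond_exp M (F n) (X (Suc n)) \<omega> \<partial>M)"
      using real_cond_exp_int(2)[OF X(2)] by simp
    also have "\<dots> = (\<integral>\<omega>. X n \<omega> \<partial>M)"
      using step X(2) by (intro integral_cong_AE) auto
    finally show ?case using Suc by simp
  qed simp
  ultimately show ?thesis by (simp add: martingale_iff_constant_expectation)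
qed

section \<open>The information available at each time\<close>

context markov_market
begin

abbreviation F :: "nat \<Rightarrow> 'w measure" where "F \<equiv> info P Z0 eps"

abbreviation Z :: "(nat \<Rightarrow> 'w \<Rightarrow> real ^ 'k) \<Rightarrow> nat \<Rightarrow> 'w \<Rightarrow> real" where
  "Z \<equiv> capital Z0 eps g"

lemma filtration_info: "filtration_on P F"
proof -
  define G where "G n = {Z0 -` B \<inter> space P | B. B \<in> sets borel} \<union>
    {eps k -` B \<inter> space P | k B. k \<le> n}" for n
  have G: "G n \<subseteq> sets P" for n
    using measurable_sets[OF Z0_measurable] measurable_sets[OF eps_measurable]
    by (auto simp: G_def)
  have sF: "sets (F n) = sigma_sets (space P) (G n)" "space (F n) = space P" for n
    using G[of n] sets.space_closed unfolding info_def G_def[symmetric]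
    by (auto intro!: sets_measure_of space_measure_of)
  have "sigma_sets (space P) (G n) \<subseteq> sets P" for n
    using G[of n] by (rule sets.sigma_sets_subset)
  moreover have "sigma_sets (space P) (G m) \<subseteq> sigma_sets (space P) (G n)" if "m \<le> n" for m n
    using that by (intro sigma_sets_mono') (force simp: G_def)
  ultimately show ?thesis by (simp add: filtration_on_def subalgebra_def sF)
qed

lemma subalgebra_info: "subalgebra P (F n)"
  using filtration_onD(1)[OF filtration_info] .

sublocale info: sigma_finite_subalgebra P "F n" for n
  by (rule sigma_finite_subalgebraI[OF subalgebra_info])

lemma space_info [simp]: "space (F n) = space P"
  using subalgebra_info[of n] by (simp add: subalgebra_def)

lemma measurable_info_mono:
  "f \<in> measurable (F m) N \<Longrightarrow> m \<le> n \<Longrightarrow> f \<in> measurable (F n) N"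
  using filtration_onD(2)[OF filtration_info] measurable_from_subalg by blast

lemma measurable_info_P: "f \<in> measurable (F m) N \<Longrightarrow> f \<in> measurable P N"
  using subalgebra_info by (rule measurable_from_subalg)

lemma info_generator:
  "B \<in> sets borel \<Longrightarrow> Z0 -` B \<inter> space P \<in> sets (F n)"
  "k \<le> n \<Longrightarrow> eps k -` C \<inter> space P \<in> sets (F n)"
proof -
  let ?G = "{Z0 -` B \<inter> space P | B. B \<in> sets borel} \<union> {eps k -` B \<inter> space P | k B. k \<le> n}"
  have sF: "sets (F n) = sigma_sets (space P) ?G"
    unfolding info_def by (intro sets_measure_of) auto
  show "B \<in> sets borel \<Longrightarrow> Z0 -` B \<inter> space P \<in> sets (F n)"
    unfolding sF by (rule sigma_sets.Basic) blast
  show "k \<le> n \<Longrightarrow> eps k -` C \<inter> space P \<in> sets (F n)"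
    unfolding sF by (rule sigma_sets.Basic) blast
qed

lemma Z0_info [measurable]: "Z0 \<in> borel_measurable (F n)"
  by (rule measurableI) (auto simp: info_generator)

lemma eps_info: "k \<le> n \<Longrightarrow> eps k \<in> measurable (F n) (count_space UNIV)"
  by (rule measurableI) (auto simp: info_generator)

text \<open>
  States form a discrete space, so every function of an observed state is measurable.
\<close>

lemma state_function_info:
  fixes h :: "'m \<Rightarrow> 'd"
  assumes "k \<le> n" "\<And>i. h i \<in> space N"
  shows "(\<lambda>\<omega>. h (eps k \<omega>)) \<in> measurable (F n) N"
  using eps_info[OF assms(1)] measurable_compose[of "eps k" "F n" "count_space UNIV" h N] assms(2)
  by auto

section \<open>The conditional law of the next state\<close>

text \<open>
  The Markov property is given for the real-valued conditional expectation, which discards infinite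
  values of the extended one. The indicator is bounded by \<open>1\<close>, so there are none and the extended
  version follows.
\<close>

lemma transition_probability_nn:
  "AE \<omega> in P. nn_cond_exp P (F n) (\<lambda>\<omega>. indicator {k} (eps (Suc n) \<omega>)) \<omega> = ennreal (p (eps n \<omega>) k)"
proof -
  note eps_measurable[measurable]
  let ?f = "\<lambda>\<omega>. indicator {k} (eps (Suc n) \<omega>) :: ennreal"
  have m: "?f \<in> borel_measurable P" by measurable
  have one: "AE \<omega> in P. nn_cond_exp P (F n) (\<lambda>\<omega>. 1) \<omega> = 1"
    using info.nn_cond_exp_F_meas[of "\<lambda>_. 1" n] by simp
  have le: "AE \<omega> in P. nn_cond_exp P (F n) ?f \<omega> \<le> nn_cond_exp P (F n) (\<lambda>\<omega>. 1) \<omega>"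
    using m by (intro info.nn_cond_exp_mono) (auto simp: indicator_def)
  have zero: "AE \<omega> in P. nn_cond_exp P (F n) (\<lambda>\<omega>. 0) \<omega> = 0"
    using info.nn_cond_exp_F_meas[of "\<lambda>_. 0" n] by simp
  have neg: "(\<lambda>\<omega>. ennreal (- indicator {k} (eps (Suc n) \<omega>))) = (\<lambda>\<omega>. 0)"
    by (intro ext ennreal_neg) (simp add: indicator_def)
  have pos: "(\<lambda>\<omega>. ennreal (indicator {k} (eps (Suc n) \<omega>))) = ?f"
    by (auto simp: indicator_def)
  show ?thesis
    using markov[where n = n and k = k] one le zero unfolding real_cond_exp_def neg pos
  proof eventually_elim
    case (elim \<omega>)
    then have "nn_cond_exp P (F n) ?f \<omega> < top"
      using le_less_trans[OF _ ennreal_one_less_top] by simp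
    then show ?case using elim by (metis diff_zero enn2real_0 ennreal_enn2real)
  qed
qed

text \<open>
  Partition according to the value \<open>k\<close> of the next state: on each piece \<open>X\<close> is known at
  time \<open>n\<close> and can be pulled out of the conditional expectation, which leaves the transition
  probability. Nonnegativity permits exchanging the sum over \<open>k\<close> with the integral.
\<close>

lemma nn_cond_exp_next_state:
  fixes X :: "'w \<Rightarrow> 'm \<Rightarrow> ennreal"
  assumes X: "\<And>k. (\<lambda>\<omega>. X \<omega> k) \<in> borel_measurable (F n)"
  shows "AE \<omega> in P. nn_cond_exp P (F n) (\<lambda>\<omega>. X \<omega> (eps (Suc n) \<omega>)) \<omega>
    = (\<integral>\<^sup>+k. ennreal (p (eps n \<omega>) k) * X \<omega> k \<partial>count_space UNIV)"
proof -
  note eps_measurable[measurable]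
  have XP [measurable]: "(\<lambda>\<omega>. X \<omega> k) \<in> borel_measurable P" for k
    using X by (rule measurable_info_P)
  have pF: "(\<lambda>\<omega>. ennreal (p (eps n \<omega>) k)) \<in> borel_measurable (F n)" for k
    by (rule state_function_info) auto
  have pP [measurable]: "(\<lambda>\<omega>. ennreal (p (eps n \<omega>) k)) \<in> borel_measurable P" for k
    using pF by (rule measurable_info_P)
  have "AE \<omega> in P. (\<integral>\<^sup>+k. ennreal (p (eps n \<omega>) k) * X \<omega> k \<partial>count_space UNIV)
      = nn_cond_exp P (F n) (\<lambda>\<omega>. X \<omega> (eps (Suc n) \<omega>)) \<omega>"
  proof (rule info.nn_cond_exp_charact)
    show "(\<lambda>\<omega>. X \<omega> (eps (Suc n) \<omega>)) \<in> borel_measurable P"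
      by measurable
    show "(\<lambda>\<omega>. \<integral>\<^sup>+k. ennreal (p (eps n \<omega>) k) * X \<omega> k \<partial>count_space UNIV) \<in> borel_measurable (F n)"
    proof (rule sigma_finite_measure.borel_measurable_nn_integral[OF sigma_finite_measure_count_space])
      have "(\<lambda>(k, \<omega>). ennreal (p (eps n \<omega>) k) * X \<omega> k)
          \<in> borel_measurable (count_space UNIV \<Otimes>\<^sub>M F n)"
        by (rule measurable_pair_measure_countable1) (use X pF in auto)
      then show "(\<lambda>(\<omega>, k). ennreal (p (eps n \<omega>) k) * X \<omega> k)
          \<in> borel_measurable (F n \<Otimes>\<^sub>M count_space UNIV)"
        by (subst (asm) measurable_pair_swap_iff) (simp add: case_prod_unfold)
    qed
    fix A assume A: "A \<in> sets (F n)"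
    then have AP [measurable]: "A \<in> sets P"
      using subalgebra_info[of n] by (auto simp: subalgebra_def)
    have "(\<integral>\<^sup>+\<omega>\<in>A. X \<omega> (eps (Suc n) \<omega>) \<partial>P)
        = (\<integral>\<^sup>+\<omega>. (\<integral>\<^sup>+k. X \<omega> k * indicator A \<omega> * indicator {k} (eps (Suc n) \<omega>) \<partial>count_space UNIV) \<partial>P)"
    proof (rule nn_integral_cong)
      fix \<omega>
      have "(\<integral>\<^sup>+k. X \<omega> k * indicator A \<omega> * indicator {k} (eps (Suc n) \<omega>) \<partial>count_space UNIV)
          = (\<integral>\<^sup>+k. X \<omega> k * indicator A \<omega> * indicator {eps (Suc n) \<omega>} k \<partial>count_space UNIV)"
        by (intro nn_integral_cong) (auto simp: indicator_def)
      also have "\<dots> = X \<omega> (eps (Suc n) \<omega>) * indicator A \<omega>"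
        by (subst nn_integral_indicator_singleton) auto
      finally show "X \<omega> (eps (Suc n) \<omega>) * indicator A \<omega>
          = (\<integral>\<^sup>+k. X \<omega> k * indicator A \<omega> * indicator {k} (eps (Suc n) \<omega>) \<partial>count_space UNIV)" ..
    qed
    also have "\<dots> = (\<integral>\<^sup>+k. (\<integral>\<^sup>+\<omega>. X \<omega> k * indicator A \<omega> * indicator {k} (eps (Suc n) \<omega>) \<partial>P) \<partial>count_space UNIV)"
      by (rule nn_integral_count_space_nn_integral) auto
    also have "\<dots> = (\<integral>\<^sup>+k. (\<integral>\<^sup>+\<omega>. ennreal (p (eps n \<omega>) k) * X \<omega> k * indicator A \<omega> \<partial>P) \<partial>count_space UNIV)"
    proof (rule nn_integral_cong)
      fix k
      have "(\<integral>\<^sup>+\<omega>. (X \<omega> k * indicator A \<omega>) * indicator {k} (eps (Suc n) \<omega>) \<partial>P)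
          = (\<integral>\<^sup>+\<omega>. (X \<omega> k * indicator A \<omega>)
              * nn_cond_exp P (F n) (\<lambda>\<omega>. indicator {k} (eps (Suc n) \<omega>)) \<omega> \<partial>P)"
        using A X by (intro info.nn_cond_exp_intg[symmetric]) auto
      also have "\<dots> = (\<integral>\<^sup>+\<omega>. ennreal (p (eps n \<omega>) k) * X \<omega> k * indicator A \<omega> \<partial>P)"
        using transition_probability_nn[of n k]
        by (intro nn_integral_cong_AE) (auto elim!: eventually_mono simp: mult_ac)
      finally show "(\<integral>\<^sup>+\<omega>. X \<omega> k * indicator A \<omega> * indicator {k} (eps (Suc n) \<omega>) \<partial>P)
        = (\<integral>\<^sup>+\<omega>. ennreal (p (eps n \<omega>) k) * X \<omega> k * indicator A \<omega> \<partial>P)" .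
    qed
    also have "\<dots> = (\<integral>\<^sup>+\<omega>. (\<integral>\<^sup>+k. ennreal (p (eps n \<omega>) k) * X \<omega> k * indicator A \<omega> \<partial>count_space UNIV) \<partial>P)"
      by (rule nn_integral_count_space_nn_integral[symmetric]) auto
    also have "\<dots> = (\<integral>\<^sup>+\<omega>\<in>A. (\<integral>\<^sup>+k. ennreal (p (eps n \<omega>) k) * X \<omega> k \<partial>count_space UNIV) \<partial>P)"
      by (intro nn_integral_cong nn_integral_multc) auto
    finally show "(\<integral>\<^sup>+\<omega>\<in>A. X \<omega> (eps (Suc n) \<omega>) \<partial>P)
      = (\<integral>\<^sup>+\<omega>\<in>A. (\<integral>\<^sup>+k. ennreal (p (eps n \<omega>) k) * X \<omega> k \<partial>count_space UNIV) \<partial>P)" .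
  qed
  then show ?thesis by eventually_elim simp
qed

text \<open>
  The signed case. Applied to the absolute value, the nonnegative case shows that the series
  converges absolutely almost surely; then the series of the positive and the negative part can be
  subtracted.
\<close>

lemma cond_exp_next_state:
  fixes X :: "'w \<Rightarrow> 'm \<Rightarrow> real"
  assumes X: "\<And>k. (\<lambda>\<omega>. X \<omega> k) \<in> borel_measurable (F n)"
    and int: "integrable P (\<lambda>\<omega>. X \<omega> (eps (Suc n) \<omega>))"
  shows "AE \<omega> in P. ((\<lambda>k. p (eps n \<omega>) k * X \<omega> k) has_sum
    real_cond_exp P (F n) (\<lambda>\<omega>. X \<omega> (eps (Suc n) \<omega>)) \<omega>) UNIV"
proof -
  note eps_measurable[measurable]
  have XP [measurable]: "(\<lambda>\<omega>. X \<omega> k) \<in> borel_measurable P" for k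
    using X by (rule measurable_info_P)
  have pos: "AE \<omega> in P. nn_cond_exp P (F n) (\<lambda>\<omega>. ennreal (X \<omega> (eps (Suc n) \<omega>))) \<omega>
    = (\<integral>\<^sup>+k. ennreal (p (eps n \<omega>) k * X \<omega> k) \<partial>count_space UNIV)"
    using nn_cond_exp_next_state[of "\<lambda>\<omega> k. ennreal (X \<omega> k)" n] X
    by (simp add: ennreal_mult' p_nonneg)
  have neg: "AE \<omega> in P. nn_cond_exp P (F n) (\<lambda>\<omega>. ennreal (- X \<omega> (eps (Suc n) \<omega>))) \<omega>
    = (\<integral>\<^sup>+k. ennreal (- (p (eps n \<omega>) k * X \<omega> k)) \<partial>count_space UNIV)"
    using nn_cond_exp_next_state[of "\<lambda>\<omega> k. ennreal (- X \<omega> k)" n] X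
    by (simp add: ennreal_mult'[symmetric] p_nonneg)
  have norm: "AE \<omega> in P. nn_cond_exp P (F n) (\<lambda>\<omega>. ennreal (norm (X \<omega> (eps (Suc n) \<omega>)))) \<omega>
    = (\<integral>\<^sup>+k. ennreal (norm (p (eps n \<omega>) k * X \<omega> k)) \<partial>count_space UNIV)"
    using nn_cond_exp_next_state[of "\<lambda>\<omega> k. ennreal (norm (X \<omega> k))" n] X
    by (simp add: ennreal_mult' p_nonneg abs_mult)
  have fin: "AE \<omega> in P. nn_cond_exp P (F n) (\<lambda>\<omega>. ennreal (norm (X \<omega> (eps (Suc n) \<omega>)))) \<omega> \<noteq> \<infinity>"
  proof (rule nn_integral_PInf_AE)
    have "(\<integral>\<^sup>+\<omega>. nn_cond_exp P (F n) (\<lambda>\<omega>. ennreal (norm (X \<omega> (eps (Suc n) \<omega>)))) \<omega> \<partial>P)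
        = (\<integral>\<^sup>+\<omega>. ennreal (norm (X \<omega> (eps (Suc n) \<omega>))) \<partial>P)"
      using info.nn_cond_exp_intg[of "\<lambda>_. 1" n "\<lambda>\<omega>. ennreal (norm (X \<omega> (eps (Suc n) \<omega>)))"]
      by simp
    then show "(\<integral>\<^sup>+\<omega>. nn_cond_exp P (F n) (\<lambda>\<omega>. ennreal (norm (X \<omega> (eps (Suc n) \<omega>)))) \<omega> \<partial>P) \<noteq> \<infinity>"
      using int by (simp add: integrable_iff_bounded)
  qed auto
  show ?thesis
    using pos neg norm fin
  proof eventually_elim
    case (elim \<omega>)
    let ?c = "\<lambda>k. p (eps n \<omega>) k * X \<omega> k"
    have c: "integrable (count_space UNIV) ?c"
      using elim(3,4) by (auto simp: integrable_iff_bounded less_top)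
    then have ab: "Infinite_Set_Sum.abs_summable_on ?c UNIV"
      by (simp add: abs_summable_on_def)
    have "real_cond_exp P (F n) (\<lambda>\<omega>. X \<omega> (eps (Suc n) \<omega>)) \<omega> = (\<integral>k. ?c k \<partial>count_space UNIV)"
      unfolding real_cond_exp_def real_lebesgue_integral_def[OF c] using elim(1,2) by simp
    also have "\<dots> = infsum ?c UNIV"
      using infsetsum_infsum[OF ab] by (simp add: infsetsum_def)
    finally show ?case
      using Infinite_Sum.abs_summable_summable ab unfolding abs_summable_equivalent[symmetric]
      by (metis has_sum_infsum)
  qed
qed

text \<open>
  What holds at the realised next state holds at every state reachable with positive probability.
  This turns \<open>cond_a2\<close> into a bound on all returns that enter a conditional mean.
\<close>

lemma AE_all_transitions:
  assumes Q: "\<And>k. Measurable.pred (F n) (\<lambda>\<omega>. Q \<omega> k)"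
    and "AE \<omega> in P. Q \<omega> (eps (Suc n) \<omega>)"
  shows "AE \<omega> in P. \<forall>k. 0 < p (eps n \<omega>) k \<longrightarrow> Q \<omega> k"
proof -
  \<comment> \<open>The conditional mean of this indicator of failure is a series of nonnegative terms with sum zero.\<close>
  define X :: "'w \<Rightarrow> 'm \<Rightarrow> real" where "X \<omega> k = (if Q \<omega> k then 0 else 1)" for \<omega> k
  have X: "(\<lambda>\<omega>. X \<omega> k) \<in> borel_measurable (F n)" for k
    unfolding X_def using Q by measurable
  note eps_measurable[measurable]
  have XP [measurable]: "(\<lambda>\<omega>. X \<omega> k) \<in> borel_measurable P" for k
    using X by (rule measurable_info_P)
  have m: "(\<lambda>\<omega>. X \<omega> (eps (Suc n) \<omega>)) \<in> borel_measurable P"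
    by measurable
  have int: "integrable P (\<lambda>\<omega>. X \<omega> (eps (Suc n) \<omega>))"
    by (rule integrable_const_bound[where B = 1]) (use m in \<open>auto simp: X_def\<close>)
  have "AE \<omega> in P. X \<omega> (eps (Suc n) \<omega>) = 0"
    using assms(2) by eventually_elim (simp add: X_def)
  then have "AE \<omega> in P. real_cond_exp P (F n) (\<lambda>\<omega>. X \<omega> (eps (Suc n) \<omega>)) \<omega>
      = real_cond_exp P (F n) (\<lambda>\<omega>. 0) \<omega>"
    using m by (intro info.real_cond_exp_cong) auto
  moreover have "AE \<omega> in P. real_cond_exp P (F n) (\<lambda>\<omega>. 0) \<omega> = 0"
    using info.real_cond_exp_F_meas[of "\<lambda>_. 0" n] by simp
  ultimately show ?thesis using cond_exp_next_state[OF X int]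
  proof eventually_elim
    case (elim \<omega>)
    then have "((\<lambda>k. p (eps n \<omega>) k * X \<omega> k) has_sum 0) UNIV" by simp
    then have "p (eps n \<omega>) k * X \<omega> k = 0" for k
      by (rule nonneg_has_sum_le_0D) (auto simp: X_def p_nonneg)
    then show ?case by (force simp: X_def split: if_splits)
  qed
qed

text \<open>
  There are only countably many states, so those of probability zero can be ignored together.
\<close>

lemma AE_state_positive:
  "AE \<omega> in P. 0 < prob {\<omega>' \<in> space P. eps j \<omega>' = eps j \<omega>}"
proof -
  note eps_measurable[measurable]
  have "AE \<omega> in P. eps j \<omega> = i \<longrightarrow> 0 < prob {\<omega>' \<in> space P. eps j \<omega>' = i}" for i
  proof (cases "0 < prob {\<omega>' \<in> space P. eps j \<omega>' = i}")
    case False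
    then have "prob {\<omega>' \<in> space P. eps j \<omega>' = i} = 0"
      using measure_nonneg[of P "{\<omega>' \<in> space P. eps j \<omega>' = i}"] by linarith
    then have "AE \<omega> in P. \<omega> \<notin> {\<omega>' \<in> space P. eps j \<omega>' = i}"
      by (subst (asm) prob_eq_0) auto
    then show ?thesis using AE_space by eventually_elim simp
  qed simp
  then have "AE \<omega> in P. \<forall>i. eps j \<omega> = i \<longrightarrow> 0 < prob {\<omega>' \<in> space P. eps j \<omega>' = i}"
    unfolding AE_all_countable by blast
  then show ?thesis by eventually_elim simp
qed

text \<open>
  Allows reading off statements about a single state \<open>i\<close> from almost sure statements along the
  chain.
\<close>

lemma AE_obtains_state:
  assumes "AE \<omega> in P. Q \<omega>" and pos: "0 < prob {\<omega> \<in> space P. eps j \<omega> = i}"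
  obtains \<omega> where "eps j \<omega> = i" and "Q \<omega>"
proof -
  note eps_measurable[measurable]
  have "\<exists>\<omega>. eps j \<omega> = i \<and> Q \<omega>"
  proof (rule ccontr)
    assume no: "\<not> (\<exists>\<omega>. eps j \<omega> = i \<and> Q \<omega>)"
    have "AE \<omega> in P. \<omega> \<notin> {\<omega> \<in> space P. eps j \<omega> = i}"
      using assms(1) by eventually_elim (use no in blast)
    moreover have "{\<omega> \<in> space P. eps j \<omega> = i} \<in> sets P"
      by measurable
    ultimately have "prob {\<omega> \<in> space P. eps j \<omega> = i} = 0"
      by (subst prob_eq_0)
    with pos show False by simp
  qed
  with that show thesis by blast
qed

section \<open>Capital and log-growth over one period\<close>

lemma transition_function_info:
  fixes h :: "'m \<Rightarrow> 'm \<Rightarrow> 'd"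
  assumes "\<And>i k. h i k \<in> space N"
  shows "(\<lambda>\<omega>. h (eps n \<omega>) (eps (Suc n) \<omega>)) \<in> measurable (F (Suc n)) N"
proof (rule measurable_compose_countable[where f = "\<lambda>k \<omega>. h (eps n \<omega>) k" and g = "eps (Suc n)"])
  show "(\<lambda>\<omega>. h (eps n \<omega>) k) \<in> measurable (F (Suc n)) N" for k
    by (rule state_function_info[where h = "\<lambda>i. h i k"]) (simp_all add: assms)
  show "eps (Suc n) \<in> measurable (F (Suc n)) (count_space UNIV)"
    by (rule eps_info) simp
qed

lemma capital_info:
  assumes "cond_a0 P Z0 eps C"
  shows "Z C n \<in> borel_measurable (F n)"
proof (induction n)
  case 0
  have "Z C 0 = Z0" by (simp add: fun_eq_iff)
  then show ?case using Z0_info[of 0] by simp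
next
  case (Suc n)
  have "Z C n \<in> borel_measurable (F (Suc n))" "C n \<in> borel_measurable (F (Suc n))"
    using Suc assms by (auto simp: cond_a0_def intro: measurable_info_mono)
  moreover have "(\<lambda>\<omega>. g (eps n \<omega>) (eps (Suc n) \<omega>)) \<in> borel_measurable (F (Suc n))"
    by (rule transition_function_info) auto
  ultimately show ?case by (auto intro: borel_measurable_add borel_measurable_inner)
qed

text \<open>
  The ratio of the capitals at times \<open>n + 1\<close> and \<open>n\<close>, as a function of a hypothetical next
  state \<open>k\<close>; for each fixed \<open>k\<close> it is known at time \<open>n\<close>.
\<close>

definition factor :: "(nat \<Rightarrow> 'w \<Rightarrow> real ^ 'k) \<Rightarrow> nat \<Rightarrow> 'w \<Rightarrow> 'm \<Rightarrow> real" where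
  "factor C n \<omega> k = 1 + (C n \<omega> \<bullet> g (eps n \<omega>) k) / Z C n \<omega>"

definition log_incr :: "(nat \<Rightarrow> 'w \<Rightarrow> real ^ 'k) \<Rightarrow> nat \<Rightarrow> 'w \<Rightarrow> real" where
  "log_incr C n \<omega> = phi (eps n \<omega>) (eps (Suc n) \<omega>) * ln (Z C (Suc n) \<omega> / Z C n \<omega>)"

abbreviation growth :: "(nat \<Rightarrow> 'w \<Rightarrow> real ^ 'k) \<Rightarrow> nat \<Rightarrow> 'w \<Rightarrow> real" where
  "growth \<equiv> log_growth Z0 eps g phi"

lemma growth_0 [simp]: "growth C 0 \<omega> = 0"
  by (simp add: log_growth_def)

lemma growth_Suc: "growth C (Suc n) \<omega> = growth C n \<omega> + log_incr C n \<omega>"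
  by (simp add: log_growth_def log_incr_def)

lemma factor_info:
  assumes "cond_a0 P Z0 eps C"
  shows "(\<lambda>\<omega>. factor C n \<omega> k) \<in> borel_measurable (F n)"
proof -
  have [measurable]: "Z C n \<in> borel_measurable (F n)" "C n \<in> borel_measurable (F n)"
    using assms capital_info by (auto simp: cond_a0_def)
  have [measurable]: "(\<lambda>\<omega>. g (eps n \<omega>) k) \<in> borel_measurable (F n)"
    by (rule state_function_info) auto
  show ?thesis unfolding factor_def by measurable
qed

lemma log_incr_info:
  assumes "cond_a0 P Z0 eps C"
  shows "log_incr C n \<in> borel_measurable (F (Suc n))"
proof -
  have [measurable]: "Z C n \<in> borel_measurable (F (Suc n))" "Z C (Suc n) \<in> borel_measurable (F (Suc n))"
    using capital_info[OF assms] measurable_info_mono[OF capital_info[OF assms], of n "Suc n"] by simp_all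
  have [measurable]: "(\<lambda>\<omega>. phi (eps n \<omega>) (eps (Suc n) \<omega>)) \<in> borel_measurable (F (Suc n))"
    by (rule transition_function_info) auto
  have "(\<lambda>\<omega>. phi (eps n \<omega>) (eps (Suc n) \<omega>) * ln (Z C (Suc n) \<omega> / Z C n \<omega>))
      \<in> borel_measurable (F (Suc n))"
    by measurable
  then show ?thesis by (simp add: log_incr_def[abs_def])
qed

lemma growth_info:
  assumes "cond_a0 P Z0 eps C"
  shows "growth C n \<in> borel_measurable (F n)"
proof (induction n)
  case (Suc n)
  then have "growth C n \<in> borel_measurable (F (Suc n))" by (rule measurable_info_mono) simp
  then have "(\<lambda>\<omega>. growth C n \<omega> + log_incr C n \<omega>) \<in> borel_measurable (F (Suc n))"
    using log_incr_info[OF assms] by measurable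
  then show ?case by (subst measurable_cong[OF growth_Suc])
next
  case 0
  show ?case by (subst measurable_cong[OF growth_0]) simp
qed

lemma log_incr_integrable:
  assumes "growth_integrable P Z0 eps g phi C"
  shows "integrable P (log_incr C n)"
proof -
  have "log_incr C n = (\<lambda>\<omega>. growth C (Suc n) \<omega> - growth C n \<omega>)"
    by (simp add: growth_Suc fun_eq_iff)
  then show ?thesis using assms by (simp add: growth_integrable_def)
qed

lemma capital_pos:
  assumes "cond_a1 P Z0 eps g C"
  shows "AE \<omega> in P. 0 < Z C n \<omega>"
proof -
  have "AE \<omega> in P. (\<forall>s. C n \<omega> $ s \<ge> 0) \<and> (\<Sum>s\<in>UNIV. C n \<omega> $ s) < Z C n \<omega>"
    using assms by (simp add: cond_a1_def)
  then show ?thesis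
  proof eventually_elim
    case (elim \<omega>)
    then have "0 \<le> (\<Sum>s\<in>UNIV. C n \<omega> $ s)" by (simp add: sum_nonneg)
    with elim show ?case by linarith
  qed
qed

lemma log_incr_factor:
  assumes "AE \<omega> in P. 0 < Z C n \<omega>"
  shows "AE \<omega> in P. log_incr C n \<omega>
    = phi (eps n \<omega>) (eps (Suc n) \<omega>) * ln (factor C n \<omega> (eps (Suc n) \<omega>))"
  using assms by eventually_elim (simp add: log_incr_def factor_def add_divide_distrib)

lemma cond_a2_all_imp_cond_a2:
  assumes "cond_a2_all P Z0 eps g b C"
  shows "cond_a2 P Z0 eps g b C"
  unfolding cond_a2_def
proof
  fix j
  have "AE \<omega> in P. \<forall>l. 1 + (C j \<omega> \<bullet> g (eps j \<omega>) l) / Z C j \<omega> \<ge> b"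
    using assms by (simp add: cond_a2_all_def)
  then show "AE \<omega> in P. 1 + (C j \<omega> \<bullet> g (eps j \<omega>) (eps (Suc j) \<omega>)) / Z C j \<omega> \<ge> b"
    by eventually_elim simp
qed

lemma cond_i2_pos:
  assumes "cond_i2 g b i d"
  shows "0 < 1 + d \<bullet> g i k"
  using assms b_pos unfolding cond_i2_def by (meson less_le_trans)

lemma weighted_log_info:
  assumes "(\<lambda>\<omega>. R \<omega> k) \<in> borel_measurable (F n)"
  shows "(\<lambda>\<omega>. phi (eps n \<omega>) k * ln (R \<omega> k)) \<in> borel_measurable (F n)"
proof -
  have "(\<lambda>\<omega>. phi (eps n \<omega>) k) \<in> borel_measurable (F n)"
    by (rule state_function_info) auto
  then show ?thesis using assms by measurable
qed

lemma cond_exp_log_incr: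
  assumes a0: "cond_a0 P Z0 eps C" and a1: "cond_a1 P Z0 eps g C"
    and gi: "growth_integrable P Z0 eps g phi C"
  shows "AE \<omega> in P. ((\<lambda>k. phi (eps n \<omega>) k * p (eps n \<omega>) k * ln (factor C n \<omega> k)) has_sum
    real_cond_exp P (F n) (log_incr C n) \<omega>) UNIV"
proof -
  note eps_measurable[measurable]
  let ?X = "\<lambda>\<omega> k. phi (eps n \<omega>) k * ln (factor C n \<omega> k)"
  have X: "(\<lambda>\<omega>. ?X \<omega> k) \<in> borel_measurable (F n)" for k
    using factor_info[OF a0] by (rule weighted_log_info)
  have XP [measurable]: "(\<lambda>\<omega>. ?X \<omega> k) \<in> borel_measurable P" for k
    using X by (rule measurable_info_P)
  have m: "(\<lambda>\<omega>. ?X \<omega> (eps (Suc n) \<omega>)) \<in> borel_measurable P"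
    by (rule measurable_compose_countable[OF XP eps_measurable])
  note eq = log_incr_factor[OF capital_pos[OF a1], of n]
  note li = log_incr_integrable[OF gi, of n]
  have int: "integrable P (\<lambda>\<omega>. ?X \<omega> (eps (Suc n) \<omega>))"
    using li m eq by (subst integrable_cong_AE[symmetric]) auto
  have "AE \<omega> in P. real_cond_exp P (F n) (log_incr C n) \<omega>
      = real_cond_exp P (F n) (\<lambda>\<omega>. ?X \<omega> (eps (Suc n) \<omega>)) \<omega>"
    using eq li m by (intro info.real_cond_exp_cong) auto
  then show ?thesis using cond_exp_next_state[OF X int]
    by eventually_elim (simp add: mult_ac)
qed

end

section \<open>The drift of the compensated log-growth\<close>

text \<open>
  Calibrating functions together with a strategy balanced with respect to them. The bound from
  below on the returns is required for all next states, since transitions of probability zero can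
  carry positive weight in \<open>cond_a3\<close>.
\<close>

locale calibrated_strategy = markov_market P Z0 eps p g phi b
  for P :: "'w measure"
    and Z0 :: "'w \<Rightarrow> real"
    and eps :: "nat \<Rightarrow> 'w \<Rightarrow> 'm :: countable"
    and p :: "'m \<Rightarrow> 'm \<Rightarrow> real"
    and g :: "'m \<Rightarrow> 'm \<Rightarrow> real ^ 'k"
    and phi :: "'m \<Rightarrow> 'm \<Rightarrow> real"
    and b :: real +
  fixes q :: "nat \<Rightarrow> 'm \<Rightarrow> 'm \<Rightarrow> real"
    and C :: "nat \<Rightarrow> 'w \<Rightarrow> real ^ 'k"
  assumes cal: "calibrating P eps p phi q"
    and a0: "cond_a0 P Z0 eps C"
    and a1: "cond_a1 P Z0 eps g C"
    and a2: "cond_a2_all P Z0 eps g b C"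
    and a3: "cond_a3 P eps g phi q C"
    and gi: "growth_integrable P Z0 eps g phi C"
begin

abbreviation drift :: "nat \<Rightarrow> 'w \<Rightarrow> real" where
  "drift n \<equiv> real_cond_exp P (F n) (log_incr C n)"

abbreviation compensated :: "nat \<Rightarrow> 'w \<Rightarrow> real" where
  "compensated n \<omega> \<equiv> growth C n \<omega> - compensator eps p phi q n \<omega>"

lemma q_pos: "0 < q j i k"
  using cal by (simp add: calibrating_def)

lemma factor_pos: "AE \<omega> in P. \<forall>k. 0 < factor C n \<omega> k"
proof -
  have "AE \<omega> in P. \<forall>l. b \<le> factor C n \<omega> l"
    using a2 by (simp add: cond_a2_all_def factor_def)
  then show ?thesis by eventually_elim (use b_pos less_le_trans in blast)
qed

text \<open>
  The heart of the supermartingale property: the weighted Gibbs inequality with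
  \<open>R = factor C n \<omega>\<close>. Its correction term splits into the calibration sum, which is nonpositive,
  and a multiple of the sum in \<open>cond_a3\<close>, which is zero.
\<close>

lemma drift_le_alpha:
  "AE \<omega> in P. drift n \<omega> \<le> alpha p phi q n (eps n \<omega>) \<and>
     (drift n \<omega> = alpha p phi q n (eps n \<omega>) \<longleftrightarrow>
      (\<forall>k. 0 < phi (eps n \<omega>) k \<longrightarrow> q (Suc n) (eps n \<omega>) k * factor C n \<omega> k = p (eps n \<omega>) k))"
proof -
  have a3': "AE \<omega> in P. ((\<lambda>l. phi (eps n \<omega>) l * q (Suc n) (eps n \<omega>) l
      * (C n \<omega> \<bullet> g (eps n \<omega>) l)) has_sum 0) UNIV"
    using a3 by (simp add: cond_a3_def)
  show ?thesis
    using cond_exp_log_incr[OF a0 a1 gi, of n] capital_pos[OF a1, of n] factor_pos[of n] a3'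
  proof eventually_elim
    case (elim \<omega>)
    let ?i = "eps n \<omega>"
    define c where "c = (\<Sum>\<^sub>\<infinity>l. phi ?i l * (q (Suc n) ?i l - p ?i l))"
    have qp: "((\<lambda>l. phi ?i l * (q (Suc n) ?i l - p ?i l)) has_sum c) UNIV" and "c \<le> 0"
      using cal by (auto simp: calibrating_def cond_qp_def c_def)
    have al: "((\<lambda>l. phi ?i l * p ?i l * ln (p ?i l / q (Suc n) ?i l)) has_sum alpha p phi q n ?i) UNIV"
      using cal by (auto simp: calibrating_def alpha_def)
    have "((\<lambda>l. phi ?i l * (q (Suc n) ?i l - p ?i l)
        + phi ?i l * q (Suc n) ?i l * (C n \<omega> \<bullet> g ?i l) * inverse (Z C n \<omega>)) has_sum c + 0 * inverse (Z C n \<omega>)) UNIV"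
      by (intro has_sum_add qp has_sum_cmult_left elim)
    then have "((\<lambda>l. phi ?i l * (q (Suc n) ?i l * factor C n \<omega> l - p ?i l)) has_sum c) UNIV"
      by (simp add: factor_def algebra_simps divide_inverse)
    note * = weighted_log_sum_inequality[OF _ _ _ _ elim(1) al this \<open>c \<le> 0\<close>]
    have "0 \<le> q (Suc n) ?i l * factor C n \<omega> l" for l
      using q_pos elim(3) by (simp add: less_imp_le)
    with * show ?case using phi_nonneg p_nonneg q_pos elim(3) by auto
  qed
qed

lemma compensator_Suc:
  "compensator eps p phi q (Suc n) \<omega> = compensator eps p phi q n \<omega> + alpha p phi q n (eps n \<omega>)"
  by (simp add: compensator_def)

lemma compensator_info:
  assumes "n \<le> Suc m"
  shows "compensator eps p phi q n \<in> borel_measurable (F m)"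
  unfolding compensator_def[abs_def]
proof (rule borel_measurable_sum)
  fix j assume "j \<in> {1..n}"
  with assms show "(\<lambda>\<omega>. alpha p phi q (j - 1) (eps (j - 1) \<omega>)) \<in> borel_measurable (F m)"
    by (intro state_function_info[where h = "alpha p phi q (j - 1)"]) auto
qed

lemma compensator_integrable: "integrable P (compensator eps p phi q n)"
  unfolding compensator_def[abs_def]
  using cal by (intro Bochner_Integration.integrable_sum) (auto simp: calibrating_def)

lemma expectation_compensator:
  "(\<integral>\<omega>. compensator eps p phi q n \<omega> \<partial>P) = (\<Sum>j=1..n. \<integral>\<omega>. alpha p phi q (j - 1) (eps (j - 1) \<omega>) \<partial>P)"
  unfolding compensator_def[abs_def]
  using cal by (intro Bochner_Integration.integral_sum) (auto simp: calibrating_def)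

lemma growth_int: "integrable P (growth C n)"
  using gi by (simp add: growth_integrable_def)

lemma compensated_adapted: "compensated n \<in> borel_measurable (F n)"
  using growth_info[OF a0, of n] compensator_info[of n n] by measurable

lemma compensated_integrable: "integrable P (compensated n)"
  using growth_int compensator_integrable by (rule Bochner_Integration.integrable_diff)

text \<open>
  The compensator at time \<open>n + 1\<close> is already known at time \<open>n\<close>, so only the last increment of the
  log-growth is averaged.
\<close>

lemma cond_exp_compensated:
  "AE \<omega> in P. real_cond_exp P (F n) (compensated (Suc n)) \<omega>
     = compensated n \<omega> + (drift n \<omega> - alpha p phi q n (eps n \<omega>))"
proof -
  let ?Y = "\<lambda>\<omega>. growth C n \<omega> - compensator eps p phi q (Suc n) \<omega>"
  have Y: "?Y \<in> borel_measurable (F n)"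
    using growth_info[OF a0, of n] compensator_info[of "Suc n" n] by measurable
  have Yi: "integrable P ?Y"
    using growth_int compensator_integrable by (rule Bochner_Integration.integrable_diff)
  have eq: "compensated (Suc n) = (\<lambda>\<omega>. ?Y \<omega> + log_incr C n \<omega>)"
    by (simp add: growth_Suc fun_eq_iff)
  show ?thesis
    unfolding eq
    using info.real_cond_exp_add[OF Yi log_incr_integrable[OF gi, of n], of n]
      info.real_cond_exp_F_meas[OF Yi Y]
    by eventually_elim (simp add: compensator_Suc)
qed

theorem compensated_supermartingale: "supermartingale P F compensated"
proof (rule supermartingale_stepI[OF filtration_info compensated_adapted compensated_integrable])
  fix n
  show "AE \<omega> in P. real_cond_exp P (F n) (compensated (Suc n)) \<omega> \<le> compensated n \<omega>"
    using cond_exp_compensated[of n] drift_le_alpha[of n] by eventually_elim simp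
qed

lemma compensated_0: "compensated 0 \<omega> = 0"
  by (simp add: compensator_def)

lemma expectation_compensated:
  "(\<integral>\<omega>. compensated n \<omega> \<partial>P) = (\<integral>\<omega>. growth C n \<omega> \<partial>P) - (\<integral>\<omega>. compensator eps p phi q n \<omega> \<partial>P)"
  using growth_int compensator_integrable by (rule Bochner_Integration.integral_diff)

theorem expected_growth_le:
  "(\<integral>\<omega>. growth C n \<omega> \<partial>P) \<le> (\<integral>\<omega>. compensator eps p phi q n \<omega> \<partial>P)"
proof -
  have "AE \<omega> in P. real_cond_exp P (F 0) (compensated n) \<omega> \<le> compensated 0 \<omega>"
    using compensated_supermartingale unfolding supermartingale_def by blast
  then have le: "AE \<omega> in P. real_cond_exp P (F 0) (compensated n) \<omega> \<le> 0"
    by (simp add: compensated_0 del: growth_0)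
  have "(\<integral>\<omega>. compensated n \<omega> \<partial>P) = (\<integral>\<omega>. real_cond_exp P (F 0) (compensated n) \<omega> \<partial>P)"
    using info.real_cond_exp_int(2)[OF compensated_integrable] by simp
  also have "\<dots> \<le> (\<integral>\<omega>. 0 \<partial>P)"
    using le by (intro integral_mono_AE info.real_cond_exp_int compensated_integrable) auto
  finally show ?thesis by (simp add: expectation_compensated)
qed

theorem martingale_iff_expectations:
  "martingale P F compensated \<longleftrightarrow>
   (\<forall>n\<ge>1. (\<integral>\<omega>. growth C n \<omega> \<partial>P) = (\<Sum>j=1..n. \<integral>\<omega>. alpha p phi q (j - 1) (eps (j - 1) \<omega>) \<partial>P))"
proof -
  have "martingale P F compensated \<longleftrightarrow> (\<forall>n. (\<integral>\<omega>. compensated n \<omega> \<partial>P) = (\<integral>\<omega>. compensated 0 \<omega> \<partial>P))"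
    by (rule martingale_iff_constant_expectation[OF compensated_supermartingale])
  also have "\<dots> \<longleftrightarrow> (\<forall>n. (\<integral>\<omega>. growth C n \<omega> \<partial>P) = (\<integral>\<omega>. compensator eps p phi q n \<omega> \<partial>P))"
    by (simp only: compensated_0 expectation_compensated) simp
  also have "\<dots> \<longleftrightarrow> (\<forall>n\<ge>1. (\<integral>\<omega>. growth C n \<omega> \<partial>P) = (\<integral>\<omega>. compensator eps p phi q n \<omega> \<partial>P))"
  proof -
    have "(\<integral>\<omega>. growth C 0 \<omega> \<partial>P) = (\<integral>\<omega>. compensator eps p phi q 0 \<omega> \<partial>P)"
      by (simp add: compensator_def)
    then show ?thesis by (metis less_one linorder_not_le)
  qed
  finally show ?thesis by (simp only: expectation_compensator)
qed

text \<open>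
  The one-step drift is the quantity in the Gibbs inequality, so the martingale property means
  equality there in every period.
\<close>

theorem martingale_iff_calibrated:
  "martingale P F compensated \<longleftrightarrow> (\<forall>n. AE \<omega> in P. \<forall>k. 0 < phi (eps n \<omega>) k \<longrightarrow>
     q (Suc n) (eps n \<omega>) k * factor C n \<omega> k = p (eps n \<omega>) k)"
proof
  assume m: "martingale P F compensated"
  show "\<forall>n. AE \<omega> in P. \<forall>k. 0 < phi (eps n \<omega>) k \<longrightarrow>
     q (Suc n) (eps n \<omega>) k * factor C n \<omega> k = p (eps n \<omega>) k"
  proof
    fix n
    have "AE \<omega> in P. real_cond_exp P (F n) (compensated (Suc n)) \<omega> = compensated n \<omega>"
      using m le_SucI[OF order_refl] unfolding martingale_def by blast
    then show "AE \<omega> in P. \<forall>k. 0 < phi (eps n \<omega>) k \<longrightarrow>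
        q (Suc n) (eps n \<omega>) k * factor C n \<omega> k = p (eps n \<omega>) k"
      using cond_exp_compensated[of n] drift_le_alpha[of n] by eventually_elim simp
  qed
next
  assume eq: "\<forall>n. AE \<omega> in P. \<forall>k. 0 < phi (eps n \<omega>) k \<longrightarrow>
     q (Suc n) (eps n \<omega>) k * factor C n \<omega> k = p (eps n \<omega>) k"
  show "martingale P F compensated"
  proof (rule martingale_stepI[OF filtration_info compensated_adapted compensated_integrable])
    fix n
    show "AE \<omega> in P. real_cond_exp P (F n) (compensated (Suc n)) \<omega> = compensated n \<omega>"
      using cond_exp_compensated[of n] drift_le_alpha[of n] eq[rule_format, of n]
      by eventually_elim simp
  qed
qed

section \<open>Invested fractions identified by the martingale property\<close>

text \<open>
  Equality in the Gibbs inequality turns \<open>cond_a3\<close> into \<open>cond_i3\<close> for the fractions held on almost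
  every path through \<open>i\<close>. As \<open>i\<close> is occupied with positive probability there is such a path, and
  its fractions can be taken; no measurable choice is involved.
\<close>

lemma fractions_at_state:
  assumes eq: "AE \<omega> in P. \<forall>k. 0 < phi (eps j \<omega>) k \<longrightarrow>
      q (Suc j) (eps j \<omega>) k * factor C j \<omega> k = p (eps j \<omega>) k"
    and pos: "0 < prob {\<omega> \<in> space P. eps j \<omega> = i}"
  shows "\<exists>d. cond_i1 d \<and> cond_i2 g b i d \<and> cond_i3 p g phi i d \<and>
    (\<forall>k. 0 < phi i k \<longrightarrow> q (Suc j) i k = p i k / (1 + d \<bullet> g i k))"
proof -
  have "AE \<omega> in P. (\<forall>s. C j \<omega> $ s \<ge> 0) \<and> (\<Sum>s\<in>UNIV. C j \<omega> $ s) < Z C j \<omega>"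
    using a1 by (simp add: cond_a1_def)
  moreover have "AE \<omega> in P. \<forall>l. b \<le> factor C j \<omega> l"
    using a2 by (simp add: cond_a2_all_def factor_def)
  moreover have "AE \<omega> in P. ((\<lambda>l. phi (eps j \<omega>) l * q (Suc j) (eps j \<omega>) l
      * (C j \<omega> \<bullet> g (eps j \<omega>) l)) has_sum 0) UNIV"
    using a3 by (simp add: cond_a3_def)
  ultimately have AE: "AE \<omega> in P. (\<forall>s. C j \<omega> $ s \<ge> 0) \<and> (\<Sum>s\<in>UNIV. C j \<omega> $ s) < Z C j \<omega> \<and>
      (\<forall>l. b \<le> factor C j \<omega> l) \<and>
      ((\<lambda>l. phi (eps j \<omega>) l * q (Suc j) (eps j \<omega>) l * (C j \<omega> \<bullet> g (eps j \<omega>) l)) has_sum 0) UNIV \<and>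
      0 < Z C j \<omega> \<and>
      (\<forall>k. 0 < phi (eps j \<omega>) k \<longrightarrow> q (Suc j) (eps j \<omega>) k * factor C j \<omega> k = p (eps j \<omega>) k)"
    (is "AE \<omega> in P. ?Q \<omega>")
    using eq capital_pos[OF a1, of j] by eventually_elim blast
  obtain \<omega> where i: "eps j \<omega> = i" and Q: "?Q \<omega>"
    by (rule AE_obtains_state[OF AE pos])
  from Q have C: "\<And>s. C j \<omega> $ s \<ge> 0" "(\<Sum>s\<in>UNIV. C j \<omega> $ s) < Z C j \<omega>"
    and bf: "\<And>l. b \<le> factor C j \<omega> l"
    and sum0: "((\<lambda>l. phi i l * q (Suc j) i l * (C j \<omega> \<bullet> g i l)) has_sum 0) UNIV"
    and Zp: "0 < Z C j \<omega>"
    and qf: "\<And>k. 0 < phi i k \<Longrightarrow> q (Suc j) i k * factor C j \<omega> k = p i k"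
    unfolding i by blast+
  \<comment> \<open>The fractions held at time \<open>j\<close> on this path.\<close>
  define d where "d = (1 / Z C j \<omega>) *\<^sub>R C j \<omega>"
  have dg: "d \<bullet> g i k = (C j \<omega> \<bullet> g i k) / Z C j \<omega>" "1 + d \<bullet> g i k = factor C j \<omega> k" for k
    by (auto simp: d_def factor_def i)
  have fpos: "0 < factor C j \<omega> k" for k
    using bf[of k] b_pos by linarith
  have "(\<Sum>s\<in>UNIV. d $ s) = (\<Sum>s\<in>UNIV. C j \<omega> $ s) / Z C j \<omega>"
    by (simp add: d_def sum_divide_distrib)
  then have "cond_i1 d"
    using C Zp by (simp add: cond_i1_def d_def)
  moreover have "cond_i2 g b i d"
    using bf by (simp add: cond_i2_def dg(2))
  moreover have "cond_i3 p g phi i d"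
  proof -
    have "phi i l * q (Suc j) i l * (C j \<omega> \<bullet> g i l) * inverse (Z C j \<omega>)
        = phi i l * p i l * ((d \<bullet> g i l) / (1 + d \<bullet> g i l))" for l
    proof (cases "0 < phi i l")
      case True
      from qf[OF this] fpos[of l] have "q (Suc j) i l = p i l / factor C j \<omega> l"
        by (simp add: field_simps)
      then show ?thesis unfolding dg(2) unfolding dg(1) by (simp add: field_simps)
    next
      case False
      with phi_nonneg[of i l] show ?thesis by simp
    qed
    with has_sum_cmult_left[OF sum0, of "inverse (Z C j \<omega>)"] show ?thesis
      by (simp add: cond_i3_def)
  qed
  moreover have "q (Suc j) i k = p i k / (1 + d \<bullet> g i k)" if "0 < phi i k" for k
    using qf[OF that] fpos[of k] by (simp add: dg(2) field_simps)
  ultimately show ?thesis by blast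
qed

text \<open>
  The return per unit of capital on a weighted transition equals \<open>p / q - 1\<close> on almost every path
  through \<open>i\<close>, so fractions read off one path reproduce the returns on all of them. They may
  depend on the time \<open>j\<close>, because the calibrating functions may, and they are determined only
  through their returns on transitions of positive weight from states that are occupied with
  positive probability at time \<open>j\<close>.
\<close>

theorem martingale_iff_fractions:
  "martingale P F compensated \<longleftrightarrow>
   (\<exists>D. (\<forall>j i. prob {\<omega> \<in> space P. eps j \<omega> = i} > 0 \<longrightarrow>
          cond_i1 (D j i) \<and> cond_i2 g b i (D j i) \<and> cond_i3 p g phi i (D j i) \<and>
          (\<forall>k. phi i k > 0 \<longrightarrow> q (Suc j) i k = p i k / (1 + D j i \<bullet> g i k))) \<and>
        (\<forall>j. AE \<omega> in P. \<forall>k. phi (eps j \<omega>) k > 0 \<longrightarrow>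
          C j \<omega> \<bullet> g (eps j \<omega>) k = (D j (eps j \<omega>) \<bullet> g (eps j \<omega>) k) * Z C j \<omega>))"
  (is "?M \<longleftrightarrow> ?R")
proof
  assume ?M
  then have eq: "AE \<omega> in P. \<forall>k. 0 < phi (eps j \<omega>) k \<longrightarrow>
      q (Suc j) (eps j \<omega>) k * factor C j \<omega> k = p (eps j \<omega>) k" for j
    by (simp add: martingale_iff_calibrated)
  have "\<forall>j i. \<exists>d. 0 < prob {\<omega> \<in> space P. eps j \<omega> = i} \<longrightarrow>
      cond_i1 d \<and> cond_i2 g b i d \<and> cond_i3 p g phi i d \<and>
      (\<forall>k. 0 < phi i k \<longrightarrow> q (Suc j) i k = p i k / (1 + d \<bullet> g i k))"
    using fractions_at_state[OF eq] by blast
  then obtain D where D': "\<forall>j i. 0 < prob {\<omega> \<in> space P. eps j \<omega> = i} \<longrightarrow>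
      cond_i1 (D j i) \<and> cond_i2 g b i (D j i) \<and> cond_i3 p g phi i (D j i) \<and>
      (\<forall>k. 0 < phi i k \<longrightarrow> q (Suc j) i k = p i k / (1 + D j i \<bullet> g i k))"
    unfolding choice_iff by (rule exE)
  note D = D'[rule_format]
  have "AE \<omega> in P. \<forall>k. phi (eps j \<omega>) k > 0 \<longrightarrow>
      C j \<omega> \<bullet> g (eps j \<omega>) k = (D j (eps j \<omega>) \<bullet> g (eps j \<omega>) k) * Z C j \<omega>" for j
    using eq[of j] AE_state_positive[of j] capital_pos[OF a1, of j]
  proof eventually_elim
    case (elim \<omega>)
    show ?case
    proof (intro allI impI)
      fix k assume k: "0 < phi (eps j \<omega>) k"
      let ?y = "1 + D j (eps j \<omega>) \<bullet> g (eps j \<omega>) k"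
      have y: "0 < ?y" using D[OF elim(2)] by (intro cond_i2_pos) blast
      have "q (Suc j) (eps j \<omega>) k = p (eps j \<omega>) k / ?y" using D[OF elim(2)] k by blast
      then have "q (Suc j) (eps j \<omega>) k * ?y = p (eps j \<omega>) k" using y by simp
      with elim(1) k have "q (Suc j) (eps j \<omega>) k * factor C j \<omega> k = q (Suc j) (eps j \<omega>) k * ?y"
        by simp
      then have "factor C j \<omega> k = ?y"
        using q_pos[of "Suc j" "eps j \<omega>" k] by simp
      then show "C j \<omega> \<bullet> g (eps j \<omega>) k = (D j (eps j \<omega>) \<bullet> g (eps j \<omega>) k) * Z C j \<omega>"
        using elim(3) by (simp add: factor_def field_simps)
    qed
  qed
  then have "\<forall>j. AE \<omega> in P. \<forall>k. phi (eps j \<omega>) k > 0 \<longrightarrow>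
      C j \<omega> \<bullet> g (eps j \<omega>) k = (D j (eps j \<omega>) \<bullet> g (eps j \<omega>) k) * Z C j \<omega>" ..
  with D' show ?R by (intro exI[of _ D] conjI)
next
  assume ?R
  then obtain D where R: "(\<forall>j i. prob {\<omega> \<in> space P. eps j \<omega> = i} > 0 \<longrightarrow>
          cond_i1 (D j i) \<and> cond_i2 g b i (D j i) \<and> cond_i3 p g phi i (D j i) \<and>
          (\<forall>k. phi i k > 0 \<longrightarrow> q (Suc j) i k = p i k / (1 + D j i \<bullet> g i k))) \<and>
        (\<forall>j. AE \<omega> in P. \<forall>k. phi (eps j \<omega>) k > 0 \<longrightarrow>
          C j \<omega> \<bullet> g (eps j \<omega>) k = (D j (eps j \<omega>) \<bullet> g (eps j \<omega>) k) * Z C j \<omega>)"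
    by (rule exE)
  note D = R[THEN conjunct1, rule_format] and CD = R[THEN conjunct2, rule_format]
  show ?M
    unfolding martingale_iff_calibrated
  proof
    fix j
    show "AE \<omega> in P. \<forall>k. 0 < phi (eps j \<omega>) k \<longrightarrow>
        q (Suc j) (eps j \<omega>) k * factor C j \<omega> k = p (eps j \<omega>) k"
      using CD[of j] AE_state_positive[of j] capital_pos[OF a1, of j]
    proof eventually_elim
      case (elim \<omega>)
      show ?case
      proof (intro allI impI)
        fix k assume k: "0 < phi (eps j \<omega>) k"
        let ?y = "1 + D j (eps j \<omega>) \<bullet> g (eps j \<omega>) k"
        have "0 < ?y" using D[OF elim(2)] by (intro cond_i2_pos) blast
        moreover have "factor C j \<omega> k = ?y" using elim(1,3) k by (simp add: factor_def)
        ultimately show "q (Suc j) (eps j \<omega>) k * factor C j \<omega> k = p (eps j \<omega>) k"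
          using D[OF elim(2)] k by simp
      qed
    qed
  qed
qed

text \<open>
  If the returns on weighted transitions determine a portfolio vector, then the fractions obtained
  at different times from a common calibrating function coincide, and every state is visited at some
  time. The fractions for \<open>i\<close> are therefore read off at any time at which \<open>i\<close> is visited.
\<close>

theorem martingale_imp_proportional:
  assumes m: "martingale P F compensated"
    and q: "\<And>j. q j = q 0" and phi: "\<And>i k. 0 < phi i k"
    and reach: "\<And>i. \<exists>j. 0 < prob {\<omega> \<in> space P. eps j \<omega> = i}"
    and nd: "\<And>i. nondegenerate p g phi i"
  shows "\<exists>D. (\<forall>i. cond_i1 (D i) \<and> cond_i2 g b i (D i) \<and> cond_i3 p g phi i (D i)) \<and>
    cond_i4 p g q D \<and> cond_ii P Z0 eps g D C"
proof -
  obtain D where D: "\<And>j i. 0 < prob {\<omega> \<in> space P. eps j \<omega> = i} \<Longrightarrow>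
        cond_i1 (D j i) \<and> cond_i2 g b i (D j i) \<and> cond_i3 p g phi i (D j i)"
      and Dq: "\<And>j i k. 0 < prob {\<omega> \<in> space P. eps j \<omega> = i} \<Longrightarrow> q 0 i k = p i k / (1 + D j i \<bullet> g i k)"
      and CD: "\<And>j. AE \<omega> in P. \<forall>k.
        C j \<omega> \<bullet> g (eps j \<omega>) k = (D j (eps j \<omega>) \<bullet> g (eps j \<omega>) k) * Z C j \<omega>"
  proof -
    from m obtain D where R: "(\<forall>j i. prob {\<omega> \<in> space P. eps j \<omega> = i} > 0 \<longrightarrow>
          cond_i1 (D j i) \<and> cond_i2 g b i (D j i) \<and> cond_i3 p g phi i (D j i) \<and>
          (\<forall>k. phi i k > 0 \<longrightarrow> q (Suc j) i k = p i k / (1 + D j i \<bullet> g i k))) \<and>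
        (\<forall>j. AE \<omega> in P. \<forall>k. phi (eps j \<omega>) k > 0 \<longrightarrow>
          C j \<omega> \<bullet> g (eps j \<omega>) k = (D j (eps j \<omega>) \<bullet> g (eps j \<omega>) k) * Z C j \<omega>)"
      unfolding martingale_iff_fractions by (rule exE)
    show thesis
    proof (rule that[of D])
      fix j i k
      assume pos: "0 < prob {\<omega> \<in> space P. eps j \<omega> = i}"
      show "cond_i1 (D j i) \<and> cond_i2 g b i (D j i) \<and> cond_i3 p g phi i (D j i)"
        using R pos by blast
      have "q (Suc j) i k = p i k / (1 + D j i \<bullet> g i k)" using R pos phi[of i k] by blast
      then show "q 0 i k = p i k / (1 + D j i \<bullet> g i k)" by (simp add: q[of "Suc j"])
    next
      fix j
      show "AE \<omega> in P. \<forall>k. C j \<omega> \<bullet> g (eps j \<omega>) k = (D j (eps j \<omega>) \<bullet> g (eps j \<omega>) k) * Z C j \<omega>"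
        using R phi by simp
    qed
  qed
  have separate: "v = w" if "\<And>k. v \<bullet> g i k = w \<bullet> g i k" for v w i
    using nd[of i] that unfolding nondegenerate_def by (metis inner_diff_left right_minus_eq)
  have same: "D j i = D j' i"
    if j: "0 < prob {\<omega> \<in> space P. eps j \<omega> = i}" and j': "0 < prob {\<omega> \<in> space P. eps j' \<omega> = i}" for j j' i
  proof (rule separate)
    fix k
    have "1 + D j i \<bullet> g i k = p i k / q 0 i k"
      if "0 < prob {\<omega> \<in> space P. eps j \<omega> = i}" for j
    proof -
      from Dq[OF that, of k] q_pos[of 0 i k] have "1 + D j i \<bullet> g i k \<noteq> 0" by auto
      with Dq[OF that, of k] q_pos[of 0 i k] show ?thesis by (simp add: field_simps)
    qed
    from this[OF j] this[OF j'] show "D j i \<bullet> g i k = D j' i \<bullet> g i k" by simp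
  qed
  obtain J where J: "\<And>i. 0 < prob {\<omega> \<in> space P. eps (J i) \<omega> = i}" using reach by metis
  define D' where "D' i = D (J i) i" for i
  have "cond_ii P Z0 eps g D' C"
    unfolding cond_ii_def
  proof
    fix j
    show "AE \<omega> in P. \<forall>s. C j \<omega> $ s = D' (eps j \<omega>) $ s * Z C j \<omega>"
      using CD[of j] AE_state_positive[of j]
    proof eventually_elim
      case (elim \<omega>)
      have "C j \<omega> = Z C j \<omega> *\<^sub>R D j (eps j \<omega>)"
        by (rule separate[of _ "eps j \<omega>"]) (use elim(1) in \<open>simp add: mult.commute\<close>)
      then show ?case using same[OF elim(2) J] by (simp add: D'_def mult.commute)
    qed
  qed
  moreover have "cond_i4 p g q D'"
    unfolding cond_i4_def D'_def
  proof (intro allI)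
    fix j i k
    show "q j i k = p i k / (1 + D (J i) i \<bullet> g i k)"
      using Dq[OF J, of i k] by (simp add: q[of j])
  qed
  moreover have "\<forall>i. cond_i1 (D' i) \<and> cond_i2 g b i (D' i) \<and> cond_i3 p g phi i (D' i)"
    using D[OF J] by (simp add: D'_def)
  ultimately show ?thesis by (intro exI[of _ D'] conjI)
qed

end

section \<open>Proportional portfolios\<close>

context markov_market
begin

text \<open>
  Capital is multiplied by \<open>1 + D i \<bullet> g i k \<ge> b > 0\<close> in every period.
\<close>

lemma proportional_capital_pos:
  assumes ii: "cond_ii P Z0 eps g D C" and i2: "\<And>i. cond_i2 g b i (D i)"
  shows "AE \<omega> in P. 0 < Z C n \<omega>"
proof (induction n)
  case 0
  show ?case using Z0_pos by simp
next
  case (Suc n)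
  have "AE \<omega> in P. \<forall>s. C n \<omega> $ s = D (eps n \<omega>) $ s * Z C n \<omega>"
    using ii by (simp add: cond_ii_def)
  with Suc show ?case
  proof eventually_elim
    case (elim \<omega>)
    let ?y = "1 + D (eps n \<omega>) \<bullet> g (eps n \<omega>) (eps (Suc n) \<omega>)"
    have "C n \<omega> = Z C n \<omega> *\<^sub>R D (eps n \<omega>)" using elim(2) by (simp add: vec_eq_iff)
    then have "Z C (Suc n) \<omega> = Z C n \<omega> * ?y" by (simp add: algebra_simps)
    moreover have "0 < ?y" by (rule cond_i2_pos[OF i2])
    ultimately show ?case using elim(1) by simp
  qed
qed

lemma proportional_strategy:
  assumes ii: "cond_ii P Z0 eps g D C" and i2: "\<And>i. cond_i2 g b i (D i)"
  shows "AE \<omega> in P. 0 < Z C n \<omega> \<and> C n \<omega> = Z C n \<omega> *\<^sub>R D (eps n \<omega>) \<and>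
    (\<forall>k. factor C n \<omega> k = 1 + D (eps n \<omega>) \<bullet> g (eps n \<omega>) k)"
proof -
  have "AE \<omega> in P. \<forall>s. C n \<omega> $ s = D (eps n \<omega>) $ s * Z C n \<omega>"
    using ii by (simp add: cond_ii_def)
  with proportional_capital_pos[OF ii i2, of n] show ?thesis
  proof eventually_elim
    case (elim \<omega>)
    have "C n \<omega> = Z C n \<omega> *\<^sub>R D (eps n \<omega>)" using elim(2) by (simp add: vec_eq_iff)
    with elim(1) show ?case by (simp add: factor_def)
  qed
qed

lemma proportional_cond_a1:
  assumes ii: "cond_ii P Z0 eps g D C" and i1: "\<And>i. cond_i1 (D i)" and i2: "\<And>i. cond_i2 g b i (D i)"
  shows "cond_a1 P Z0 eps g C"
  unfolding cond_a1_def
proof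
  fix j
  show "AE \<omega> in P. (\<forall>s. C j \<omega> $ s \<ge> 0) \<and> (\<Sum>s\<in>UNIV. C j \<omega> $ s) < Z C j \<omega>"
    using proportional_strategy[OF ii i2, of j]
  proof eventually_elim
    case (elim \<omega>)
    have "(\<Sum>s\<in>UNIV. C j \<omega> $ s) = (\<Sum>s\<in>UNIV. Z C j \<omega> * D (eps j \<omega>) $ s)"
      using elim by (metis real_scaleR_def vector_scaleR_component)
    also have "\<dots> = Z C j \<omega> * (\<Sum>s\<in>UNIV. D (eps j \<omega>) $ s)"
      by (simp add: sum_distrib_left)
    also have "\<dots> < Z C j \<omega> * 1"
      using elim i1[of "eps j \<omega>"] unfolding cond_i1_def by (intro mult_strict_left_mono) auto
    finally have "(\<Sum>s\<in>UNIV. C j \<omega> $ s) < Z C j \<omega>" by simp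
    moreover have "0 \<le> C j \<omega> $ s" for s
    proof -
      have "C j \<omega> $ s = Z C j \<omega> * D (eps j \<omega>) $ s"
        using elim by (metis real_scaleR_def vector_scaleR_component)
      then show ?thesis using elim i1[of "eps j \<omega>"] by (simp add: cond_i1_def)
    qed
    ultimately show ?case by blast
  qed
qed

lemma proportional_cond_a2_all:
  assumes ii: "cond_ii P Z0 eps g D C" and i2: "\<And>i. cond_i2 g b i (D i)"
  shows "cond_a2_all P Z0 eps g b C"
  unfolding cond_a2_all_def
proof
  fix j
  show "AE \<omega> in P. \<forall>l. 1 + (C j \<omega> \<bullet> g (eps j \<omega>) l) / Z C j \<omega> \<ge> b"
    using proportional_strategy[OF ii i2, of j]
    by eventually_elim (use i2 in \<open>simp add: factor_def cond_i2_def\<close>)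
qed

lemma proportional_cond_a3:
  assumes ii: "cond_ii P Z0 eps g D C" and i2: "\<And>i. cond_i2 g b i (D i)"
    and i3: "\<And>i. cond_i3 p g phi i (D i)" and i4: "cond_i4 p g q D"
  shows "cond_a3 P eps g phi q C"
  unfolding cond_a3_def
proof
  fix j
  show "AE \<omega> in P. ((\<lambda>l. phi (eps j \<omega>) l * q (Suc j) (eps j \<omega>) l
      * (C j \<omega> \<bullet> g (eps j \<omega>) l)) has_sum 0) UNIV"
    using proportional_strategy[OF ii i2, of j]
  proof eventually_elim
    case (elim \<omega>)
    let ?i = "eps j \<omega>"
    have Cg: "C j \<omega> \<bullet> g ?i l = Z C j \<omega> * (D ?i \<bullet> g ?i l)" for l
      using elim by (metis inner_scaleR_left)
    have "phi ?i l * p ?i l * ((D ?i \<bullet> g ?i l) / (1 + D ?i \<bullet> g ?i l)) * Z C j \<omega>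
        = phi ?i l * q (Suc j) ?i l * (C j \<omega> \<bullet> g ?i l)" for l
      using i4 unfolding Cg cond_i4_def by simp
    with has_sum_cmult_left[OF i3[of ?i, unfolded cond_i3_def], of "Z C j \<omega>"]
    show ?case by simp
  qed
qed

lemma proportional_log_incr:
  assumes ii: "cond_ii P Z0 eps g D C" and i2: "\<And>i. cond_i2 g b i (D i)"
  shows "AE \<omega> in P. log_incr C n \<omega> = prop_increment eps g phi D n \<omega>"
  using log_incr_factor[OF proportional_capital_pos[OF ii i2], of n]
    proportional_strategy[OF ii i2, of n]
  by eventually_elim (simp add: prop_increment_def)

lemma proportional_growth_AE:
  assumes ii: "cond_ii P Z0 eps g D C" and i2: "\<And>i. cond_i2 g b i (D i)"
  shows "AE \<omega> in P. growth C n \<omega> = (\<Sum>j=1..n. prop_increment eps g phi D (j - 1) \<omega>)"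
proof (induction n)
  case (Suc n)
  with proportional_log_incr[OF ii i2, of n] show ?case
    by eventually_elim (simp add: growth_Suc)
qed simp

text \<open>
  A strategy that invests fractions of the current capital refers to the capital that it generates
  itself; defining the capital first breaks this circle.
\<close>

primrec prop_capital :: "('m \<Rightarrow> real ^ 'k) \<Rightarrow> nat \<Rightarrow> 'w \<Rightarrow> real" where
  "prop_capital D 0 \<omega> = Z0 \<omega>"
| "prop_capital D (Suc n) \<omega> =
     prop_capital D n \<omega> * (1 + D (eps n \<omega>) \<bullet> g (eps n \<omega>) (eps (Suc n) \<omega>))"

lemma proportional_strategy_exists:
  assumes i1: "\<And>i. cond_i1 (D i)" and i2: "\<And>i. cond_i2 g b i (D i)"
    and int: "\<And>j. integrable P (prop_increment eps g phi D j)"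
  obtains C where "cond_ii P Z0 eps g D C" "cond_a0 P Z0 eps C"
    "growth_integrable P Z0 eps g phi C"
    "\<And>n. (\<integral>\<omega>. growth C n \<omega> \<partial>P) = prop_growth P eps g phi D n"
proof -
  define C where "C n \<omega> = prop_capital D n \<omega> *\<^sub>R D (eps n \<omega>)" for n \<omega>
  have Z: "Z C n \<omega> = prop_capital D n \<omega>" for n \<omega>
    by (induction n) (simp_all add: C_def algebra_simps)
  then have ii: "cond_ii P Z0 eps g D C"
    by (simp add: cond_ii_def C_def)
  have cap: "prop_capital D n \<in> borel_measurable (F n)" for n
  proof (induction n)
    case 0
    have "prop_capital D 0 = Z0" by (simp add: fun_eq_iff)
    then show ?case using Z0_info[of 0] by simp
  next
    case (Suc n)
    then have [measurable]: "prop_capital D n \<in> borel_measurable (F (Suc n))"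
      by (rule measurable_info_mono) simp
    have [measurable]: "(\<lambda>\<omega>. D (eps n \<omega>) \<bullet> g (eps n \<omega>) (eps (Suc n) \<omega>)) \<in> borel_measurable (F (Suc n))"
      by (rule transition_function_info[where h = "\<lambda>i k. D i \<bullet> g i k"]) auto
    have "(\<lambda>\<omega>. prop_capital D n \<omega> * (1 + D (eps n \<omega>) \<bullet> g (eps n \<omega>) (eps (Suc n) \<omega>)))
        \<in> borel_measurable (F (Suc n))"
      by measurable
    then show ?case by (subst measurable_cong[OF prop_capital.simps(2)])
  qed
  have a0: "cond_a0 P Z0 eps C"
    unfolding cond_a0_def
  proof
    fix j
    have [measurable]: "(\<lambda>\<omega>. D (eps j \<omega>)) \<in> borel_measurable (F j)"
      by (rule state_function_info) auto
    have "(\<lambda>\<omega>. prop_capital D j \<omega> *\<^sub>R D (eps j \<omega>)) \<in> borel_measurable (F j)"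
      using cap[of j] by measurable
    then show "C j \<in> borel_measurable (F j)" by (simp add: C_def[abs_def])
  qed
  have gm: "growth C n \<in> borel_measurable P" for n
    using growth_info[OF a0] by (rule measurable_info_P)
  have si: "integrable P (\<lambda>\<omega>. \<Sum>j=1..n. prop_increment eps g phi D (j - 1) \<omega>)" for n
    using int by (intro Bochner_Integration.integrable_sum)
  note AE = proportional_growth_AE[OF ii i2]
  have gi: "growth_integrable P Z0 eps g phi C"
    unfolding growth_integrable_def
  proof
    fix n
    show "integrable P (growth C n)"
      by (subst integrable_cong_AE[OF gm borel_measurable_integrable[OF si] AE]) (rule si)
  qed
  have "(\<integral>\<omega>. growth C n \<omega> \<partial>P) = prop_growth P eps g phi D n" for n
  proof -
    have "(\<integral>\<omega>. growth C n \<omega> \<partial>P) = (\<integral>\<omega>. (\<Sum>j=1..n. prop_increment eps g phi D (j - 1) \<omega>) \<partial>P)"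
      by (rule integral_cong_AE[OF gm borel_measurable_integrable[OF si] AE])
    also have "\<dots> = prop_growth P eps g phi D n"
      unfolding prop_growth_def beta_def using int by (intro Bochner_Integration.integral_sum) auto
    finally show ?thesis .
  qed
  with ii a0 gi show thesis by (rule that)
qed

section \<open>Comparison with a proportional benchmark\<close>

text \<open>
  The comparison principle. The Gibbs inequality with \<open>q = p / (1 + D \<bullet> g)\<close> has
  \<open>ln (p / q) = ln (1 + D \<bullet> g)\<close>, the log-growth of the benchmark, on its right-hand side. The last
  hypothesis says that the correction term vanishes, which is the first-order optimality of \<open>D\<close> in the
  direction of the competitor \<open>R\<close>. In contrast to calibrating functions, this \<open>q\<close> may be zero, but
  only where \<open>p\<close> is, and \<open>R\<close> is controlled only on transitions of positive probability.
\<close>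

lemma expectation_le_beta:
  assumes i2: "\<And>i. cond_i2 g b i (D i)"
    and Dint: "integrable P (prop_increment eps g phi D j)"
    and R: "\<And>k. (\<lambda>\<omega>. R \<omega> k) \<in> borel_measurable (F j)"
    and Rpos: "AE \<omega> in P. \<forall>k. 0 < p (eps j \<omega>) k \<longrightarrow> 0 < R \<omega> k"
    and Rint: "integrable P (\<lambda>\<omega>. phi (eps j \<omega>) (eps (Suc j) \<omega>) * ln (R \<omega> (eps (Suc j) \<omega>)))"
    and opt: "AE \<omega> in P. ((\<lambda>k. phi (eps j \<omega>) k * p (eps j \<omega>) k *
        (R \<omega> k / (1 + D (eps j \<omega>) \<bullet> g (eps j \<omega>) k) - 1)) has_sum 0) UNIV"
  shows "(\<integral>\<omega>. phi (eps j \<omega>) (eps (Suc j) \<omega>) * ln (R \<omega> (eps (Suc j) \<omega>)) \<partial>P)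
    \<le> beta P eps g phi D j"
proof -
  let ?X = "\<lambda>\<omega> k. phi (eps j \<omega>) k * ln (R \<omega> k)"
  let ?Y = "\<lambda>\<omega> k. phi (eps j \<omega>) k * ln (1 + D (eps j \<omega>) \<bullet> g (eps j \<omega>) k)"
  have X: "(\<lambda>\<omega>. ?X \<omega> k) \<in> borel_measurable (F j)" for k
    using R by (rule weighted_log_info)
  have Y: "(\<lambda>\<omega>. ?Y \<omega> k) \<in> borel_measurable (F j)" for k
    by (rule state_function_info[where h = "\<lambda>i. phi i k * ln (1 + D i \<bullet> g i k)"]) simp_all
  have eqY: "(\<lambda>\<omega>. ?Y \<omega> (eps (Suc j) \<omega>)) = prop_increment eps g phi D j"
    by (simp add: prop_increment_def fun_eq_iff)
  have ypos: "0 < 1 + D i \<bullet> g i k" for i k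
    by (rule cond_i2_pos[OF i2])
  have Yint: "integrable P (\<lambda>\<omega>. ?Y \<omega> (eps (Suc j) \<omega>))"
    using Dint by (simp only: eqY)
  have "AE \<omega> in P. real_cond_exp P (F j) (\<lambda>\<omega>. ?X \<omega> (eps (Suc j) \<omega>)) \<omega>
      \<le> real_cond_exp P (F j) (\<lambda>\<omega>. ?Y \<omega> (eps (Suc j) \<omega>)) \<omega>"
    using cond_exp_next_state[OF X Rint] cond_exp_next_state[OF Y Yint] Rpos opt
  proof eventually_elim
    case (elim \<omega>)
    let ?i = "eps j \<omega>"
    define y where "y k = 1 + D ?i \<bullet> g ?i k" for k
    have y: "0 < y k" for k using ypos by (simp add: y_def)
    let ?q = "\<lambda>k. p ?i k / y k"
    have s: "((\<lambda>k. phi ?i k * p ?i k * ln (R \<omega> k)) has_sum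
        real_cond_exp P (F j) (\<lambda>\<omega>. ?X \<omega> (eps (Suc j) \<omega>)) \<omega>) UNIV"
      using elim(1) by (simp add: mult_ac)
    have lnq: "p ?i k * (phi ?i k * ln (y k)) = phi ?i k * p ?i k * ln (p ?i k / ?q k)" for k
      using y[of k] by simp
    have a: "((\<lambda>k. phi ?i k * p ?i k * ln (p ?i k / ?q k)) has_sum
        real_cond_exp P (F j) (\<lambda>\<omega>. ?Y \<omega> (eps (Suc j) \<omega>)) \<omega>) UNIV"
      using elim(2) unfolding y_def[symmetric] lnq .
    have eqc: "phi ?i k * p ?i k * (R \<omega> k / y k - 1) = phi ?i k * (?q k * R \<omega> k - p ?i k)" for k
      by (simp add: algebra_simps)
    have c: "((\<lambda>k. phi ?i k * (?q k * R \<omega> k - p ?i k)) has_sum 0) UNIV"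
      using elim(4) unfolding y_def[symmetric] eqc .
    have "0 \<le> ?q k * R \<omega> k" for k
      using elim(3) p_nonneg[of ?i k] y[of k] by (cases "p ?i k = 0") (auto simp: less_le)
    with weighted_log_sum_inequality(1)[OF _ _ _ _ s a c order_refl]
    show ?case using phi_nonneg p_nonneg elim(3) y by simp
  qed
  then have "(\<integral>\<omega>. real_cond_exp P (F j) (\<lambda>\<omega>. ?X \<omega> (eps (Suc j) \<omega>)) \<omega> \<partial>P)
      \<le> (\<integral>\<omega>. real_cond_exp P (F j) (\<lambda>\<omega>. ?Y \<omega> (eps (Suc j) \<omega>)) \<omega> \<partial>P)"
    by (intro integral_mono_AE info.real_cond_exp_int Rint Yint)
  then show ?thesis
    using info.real_cond_exp_int(2)[OF Rint] info.real_cond_exp_int(2)[OF Yint]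
    by (simp add: beta_def eqY)
qed

lemma expected_growth_le_prop_growth:
  assumes i2: "\<And>i. cond_i2 g b i (D i)"
    and Dint: "\<And>j. integrable P (prop_increment eps g phi D j)"
    and a0: "cond_a0 P Z0 eps C" and a1: "cond_a1 P Z0 eps g C" and a2: "cond_a2 P Z0 eps g b C"
    and gi: "growth_integrable P Z0 eps g phi C"
    and opt: "\<And>j. AE \<omega> in P. ((\<lambda>k. phi (eps j \<omega>) k * p (eps j \<omega>) k *
        (factor C j \<omega> k / (1 + D (eps j \<omega>) \<bullet> g (eps j \<omega>) k) - 1)) has_sum 0) UNIV"
  shows "(\<integral>\<omega>. growth C n \<omega> \<partial>P) \<le> prop_growth P eps g phi D n"
proof -
  note eps_measurable[measurable]
  have step: "(\<integral>\<omega>. log_incr C j \<omega> \<partial>P) \<le> beta P eps g phi D j" for j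
  proof -
    have R: "(\<lambda>\<omega>. factor C j \<omega> k) \<in> borel_measurable (F j)" for k
      by (rule factor_info[OF a0])
    have "AE \<omega> in P. b \<le> factor C j \<omega> (eps (Suc j) \<omega>)"
      using a2 by (simp add: cond_a2_def factor_def)
    moreover have "Measurable.pred (F j) (\<lambda>\<omega>. b \<le> factor C j \<omega> k)" for k
      using R by measurable
    ultimately have "AE \<omega> in P. \<forall>k. 0 < p (eps j \<omega>) k \<longrightarrow> b \<le> factor C j \<omega> k"
      by (intro AE_all_transitions)
    then have Rpos: "AE \<omega> in P. \<forall>k. 0 < p (eps j \<omega>) k \<longrightarrow> 0 < factor C j \<omega> k"
      by eventually_elim (use b_pos less_le_trans in blast)
    have XP: "(\<lambda>\<omega>. phi (eps j \<omega>) k * ln (factor C j \<omega> k)) \<in> borel_measurable P" for k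
      by (rule measurable_info_P[OF weighted_log_info[OF R]])
    have m: "(\<lambda>\<omega>. phi (eps j \<omega>) (eps (Suc j) \<omega>) * ln (factor C j \<omega> (eps (Suc j) \<omega>))) \<in> borel_measurable P"
      by (rule measurable_compose_countable[OF XP eps_measurable])
    note eq = log_incr_factor[OF capital_pos[OF a1], of j]
    note li = log_incr_integrable[OF gi, of j]
    have int: "integrable P (\<lambda>\<omega>. phi (eps j \<omega>) (eps (Suc j) \<omega>) * ln (factor C j \<omega> (eps (Suc j) \<omega>)))"
      using integrable_cong_AE[OF borel_measurable_integrable[OF li] m eq] li by simp
    have "(\<integral>\<omega>. log_incr C j \<omega> \<partial>P)
        = (\<integral>\<omega>. phi (eps j \<omega>) (eps (Suc j) \<omega>) * ln (factor C j \<omega> (eps (Suc j) \<omega>)) \<partial>P)"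
      by (rule integral_cong_AE[OF borel_measurable_integrable[OF li] m eq])
    also have "\<dots> \<le> beta P eps g phi D j"
      by (rule expectation_le_beta[OF i2 Dint R Rpos int opt])
    finally show ?thesis .
  qed
  show ?thesis
  proof (induction n)
    case (Suc n)
    have "(\<integral>\<omega>. growth C (Suc n) \<omega> \<partial>P) = (\<integral>\<omega>. growth C n \<omega> \<partial>P) + (\<integral>\<omega>. log_incr C n \<omega> \<partial>P)"
      unfolding growth_Suc using gi log_incr_integrable[OF gi]
      by (intro Bochner_Integration.integral_add) (auto simp: growth_integrable_def)
    with Suc step[of n] show ?case by (simp add: prop_growth_def)
  qed (simp add: prop_growth_def)
qed

text \<open>
  Here \<open>q - p = - p * (D \<bullet> g) / (1 + D \<bullet> g)\<close>, so \<open>cond_i3\<close> says that calibration holds with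
  equality.
\<close>

lemma proportional_cond_qp:
  assumes i2: "\<And>i. cond_i2 g b i (D i)" and i3: "\<And>i. cond_i3 p g phi i (D i)"
    and i4: "cond_i4 p g q D"
  shows "((\<lambda>l. phi i l * (q j i l - p i l)) has_sum 0) UNIV"
proof -
  have "- (phi i l * p i l * ((D i \<bullet> g i l) / (1 + D i \<bullet> g i l))) = phi i l * (q j i l - p i l)" for l
  proof -
    have "0 < 1 + D i \<bullet> g i l" by (rule cond_i2_pos[OF i2])
    then have "q j i l - p i l = - (p i l * ((D i \<bullet> g i l) / (1 + D i \<bullet> g i l)))"
      using i4 by (simp add: cond_i4_def field_simps)
    then show ?thesis by (simp add: mult.assoc)
  qed
  with has_sum_uminusI[OF i3[of i, unfolded cond_i3_def]] show ?thesis by simp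
qed

text \<open>
  Every strategy balanced for \<open>q = p / (1 + D \<bullet> g)\<close> does no better in mean than the
  portfolio \<open>D\<close> itself: \<open>cond_a3\<close> and \<open>cond_i3\<close> together make the correction term of the comparison vanish.
\<close>

theorem calibrated_growth_le_prop_growth:
  assumes D: "feasible P eps p g phi b D" and i4: "cond_i4 p g q D"
    and a0: "cond_a0 P Z0 eps C" and a1: "cond_a1 P Z0 eps g C" and a2: "cond_a2 P Z0 eps g b C"
    and a3: "cond_a3 P eps g phi q C" and gi: "growth_integrable P Z0 eps g phi C"
  shows "(\<integral>\<omega>. growth C n \<omega> \<partial>P) \<le> prop_growth P eps g phi D n"
proof (rule expected_growth_le_prop_growth[OF _ _ a0 a1 a2 gi])
  have i2: "cond_i2 g b i (D i)" and i3: "cond_i3 p g phi i (D i)" for i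
    using D by (auto simp: feasible_def)
  show "cond_i2 g b i (D i)" for i by (rule i2)
  show "integrable P (prop_increment eps g phi D j)" for j
    using D by (simp add: feasible_def)
  fix j
  have "AE \<omega> in P. ((\<lambda>l. phi (eps j \<omega>) l * q (Suc j) (eps j \<omega>) l
      * (C j \<omega> \<bullet> g (eps j \<omega>) l)) has_sum 0) UNIV"
    using a3 by (simp add: cond_a3_def)
  then show "AE \<omega> in P. ((\<lambda>k. phi (eps j \<omega>) k * p (eps j \<omega>) k *
        (factor C j \<omega> k / (1 + D (eps j \<omega>) \<bullet> g (eps j \<omega>) k) - 1)) has_sum 0) UNIV"
  proof eventually_elim
    case (elim \<omega>)
    let ?i = "eps j \<omega>"
    have "((\<lambda>k. phi ?i k * (q (Suc j) ?i k - p ?i k)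
        + phi ?i k * q (Suc j) ?i k * (C j \<omega> \<bullet> g ?i k) * inverse (Z C j \<omega>)) has_sum
        0 + 0 * inverse (Z C j \<omega>)) UNIV"
      by (intro has_sum_add proportional_cond_qp[OF i2 i3 i4] has_sum_cmult_left elim)
    moreover have "phi ?i k * (q (Suc j) ?i k - p ?i k)
        + phi ?i k * q (Suc j) ?i k * (C j \<omega> \<bullet> g ?i k) * inverse (Z C j \<omega>)
      = phi ?i k * p ?i k * (factor C j \<omega> k / (1 + D ?i \<bullet> g ?i k) - 1)" for k
    proof -
      have q: "q (Suc j) ?i k = p ?i k / (1 + D ?i \<bullet> g ?i k)" using i4 by (simp add: cond_i4_def)
      have "phi ?i k * (q (Suc j) ?i k - p ?i k)
          + phi ?i k * q (Suc j) ?i k * (C j \<omega> \<bullet> g ?i k) * inverse (Z C j \<omega>)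
        = phi ?i k * (q (Suc j) ?i k * factor C j \<omega> k - p ?i k)"
        by (simp add: factor_def algebra_simps divide_inverse)
      also have "\<dots> = phi ?i k * p ?i k * (factor C j \<omega> k / (1 + D ?i \<bullet> g ?i k) - 1)"
        unfolding q by (simp add: algebra_simps)
      finally show ?thesis .
    qed
    ultimately show ?case by simp
  qed
qed

theorem optimal_portfolio_exists:
  assumes D: "feasible P eps p g phi b D"
  shows "\<exists>q C. cond_i4 p g q D \<and> cond_qp p phi q \<and> cond_ii P Z0 eps g D C \<and>
    cond_a0 P Z0 eps C \<and> cond_a1 P Z0 eps g C \<and> cond_a2 P Z0 eps g b C \<and>
    cond_a3 P eps g phi q C \<and> growth_integrable P Z0 eps g phi C \<and>
    (\<integral>\<omega>. growth C n \<omega> \<partial>P) = prop_growth P eps g phi D n"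
proof -
  have i1: "cond_i1 (D i)" and i2: "cond_i2 g b i (D i)" and i3: "cond_i3 p g phi i (D i)"
    and int: "integrable P (prop_increment eps g phi D j)" for i j
    using D by (auto simp: feasible_def)
  define q :: "nat \<Rightarrow> 'm \<Rightarrow> 'm \<Rightarrow> real" where "q j i k = p i k / (1 + D i \<bullet> g i k)" for j i k
  have i4: "cond_i4 p g q D" by (simp add: cond_i4_def q_def)
  have qp: "cond_qp p phi q"
    using proportional_cond_qp[OF i2 i3 i4] unfolding cond_qp_def
    by (auto simp: has_sum_iff)
  obtain C where C: "cond_ii P Z0 eps g D C" "cond_a0 P Z0 eps C"
    "growth_integrable P Z0 eps g phi C"
    "(\<integral>\<omega>. growth C n \<omega> \<partial>P) = prop_growth P eps g phi D n"
    using proportional_strategy_exists[OF i1 i2 int] by metis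
  have "cond_a1 P Z0 eps g C" by (rule proportional_cond_a1[OF C(1) i1 i2])
  moreover have "cond_a2 P Z0 eps g b C"
    by (rule cond_a2_all_imp_cond_a2[OF proportional_cond_a2_all[OF C(1) i2]])
  moreover have "cond_a3 P eps g phi q C" by (rule proportional_cond_a3[OF C(1) i2 i3 i4])
  ultimately show ?thesis using i4 qp C by blast
qed

section \<open>Assetwise first-order conditions\<close>

text \<open>
  The assetwise conditions are the partial derivatives of the mean log-growth at \<open>d\<close>; taking linear
  combinations gives the derivative in every direction \<open>v\<close>.
\<close>

lemma cond_i3A_has_sum:
  assumes "cond_i3A p g phi i d"
  shows "((\<lambda>l. phi i l * p i l * ((v \<bullet> g i l) / (1 + d \<bullet> g i l))) has_sum 0) UNIV"
proof -
  have "((\<lambda>l. \<Sum>s\<in>UNIV. v $ s * (p i l * ((phi i l * g i l $ s) / (1 + d \<bullet> g i l)))) has_sum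
      (\<Sum>s\<in>UNIV. v $ s * 0)) UNIV"
    using assms unfolding cond_i3A_def by (intro has_sum_finite_sum has_sum_cmult_right) auto
  moreover have "(\<Sum>s\<in>UNIV. v $ s * (p i l * ((phi i l * g i l $ s) / (1 + d \<bullet> g i l))))
      = phi i l * p i l * ((v \<bullet> g i l) / (1 + d \<bullet> g i l))" for l
    by (simp add: inner_vec_def sum_distrib_left sum_divide_distrib mult_ac)
  ultimately show ?thesis by simp
qed

text \<open>
  Subtract the derivatives at \<open>d\<close> and at \<open>e\<close> in the direction \<open>d - e\<close>. The difference is a series
  of nonnegative terms \<open>((d - e) \<bullet> g)\<^sup>2\<close> with positive factors, so it vanishes only termwise;
  this is strict concavity of the logarithm.
\<close>

lemma cond_i3A_unique:
  assumes d: "cond_i2 g b i d" "cond_i3A p g phi i d"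
    and e: "cond_i2 g b i e" "cond_i3A p g phi i e"
    and k: "0 < phi i k * p i k"
  shows "d \<bullet> g i k = e \<bullet> g i k"
proof -
  let ?x = "\<lambda>l. 1 + d \<bullet> g i l" and ?y = "\<lambda>l. 1 + e \<bullet> g i l"
  have x: "0 < ?x l" and y: "0 < ?y l" for l
    using cond_i2_pos d(1) e(1) by blast+
  let ?u = "\<lambda>l. phi i l * p i l * (((d - e) \<bullet> g i l)\<^sup>2 / (?x l * ?y l))"
  have u: "phi i l * p i l * (((d - e) \<bullet> g i l) / ?y l)
      - phi i l * p i l * (((d - e) \<bullet> g i l) / ?x l) = ?u l" for l
    using x[of l] y[of l] by (simp add: field_simps power2_eq_square inner_diff_left)
  have "((\<lambda>l. phi i l * p i l * (((d - e) \<bullet> g i l) / ?y l)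
      - phi i l * p i l * (((d - e) \<bullet> g i l) / ?x l)) has_sum 0) UNIV"
    using has_sum_add[OF cond_i3A_has_sum[OF e(2), of "d - e"]
        has_sum_uminusI[OF cond_i3A_has_sum[OF d(2), of "d - e"]]]
    by simp
  then have "(?u has_sum 0) UNIV" by (simp only: u)
  then have "?u k = 0"
    by (rule nonneg_has_sum_le_0D) (use x y phi_nonneg p_nonneg in \<open>auto intro!: mult_nonneg_nonneg divide_nonneg_pos\<close>)
  then have "(d - e) \<bullet> g i k = 0"
    using k x[of k] y[of k] by auto
  then show ?thesis by (simp add: inner_diff_left)
qed

text \<open>
  The hypothesis of the comparison principle is the derivative at \<open>d\<close> in the direction \<open>v - d\<close>, with
  \<open>v\<close> the fractions of the competitor.
\<close>

lemma cond_i3A_optimality: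
  assumes d: "cond_i2 g b i d" "cond_i3A p g phi i d"
    and r: "\<And>k. r k = 1 + v \<bullet> g i k"
  shows "((\<lambda>k. phi i k * p i k * (r k / (1 + d \<bullet> g i k) - 1)) has_sum 0) UNIV"
proof -
  have "phi i k * p i k * (((v - d) \<bullet> g i k) / (1 + d \<bullet> g i k))
      = phi i k * p i k * (r k / (1 + d \<bullet> g i k) - 1)" for k
    using cond_i2_pos[OF d(1), of k] by (simp add: r inner_diff_left field_simps)
  with cond_i3A_has_sum[OF d(2), of "v - d"] show ?thesis by simp
qed

lemma cond_i3A_beta_maximal:
  assumes i2: "\<And>i. cond_i2 g b i (D i)" and i3A: "\<And>i. cond_i3A p g phi i (D i)"
    and int: "integrable P (prop_increment eps g phi D j)"
    and i2': "\<And>i. cond_i2 g b i (D' i)" and int': "integrable P (prop_increment eps g phi D' j)"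
  shows "beta P eps g phi D' j \<le> beta P eps g phi D j"
proof -
  let ?R = "\<lambda>\<omega> k. 1 + D' (eps j \<omega>) \<bullet> g (eps j \<omega>) k"
  have eq: "prop_increment eps g phi D' j
      = (\<lambda>\<omega>. phi (eps j \<omega>) (eps (Suc j) \<omega>) * ln (?R \<omega> (eps (Suc j) \<omega>)))"
    by (simp add: prop_increment_def fun_eq_iff)
  have R: "(\<lambda>\<omega>. ?R \<omega> k) \<in> borel_measurable (F j)" for k
    by (rule state_function_info[where h = "\<lambda>i. 1 + D' i \<bullet> g i k"]) simp_all
  show ?thesis
    unfolding beta_def[of P eps g phi D'] eq
    by (rule expectation_le_beta[OF i2 int R])
      (use cond_i2_pos[OF i2'] int' cond_i3A_optimality[OF i2 i3A] in \<open>auto simp: eq\<close>)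
qed

lemma cond_i3A_growth_maximal:
  assumes i2: "\<And>i. cond_i2 g b i (D i)" and i3A: "\<And>i. cond_i3A p g phi i (D i)"
    and int: "\<And>j. integrable P (prop_increment eps g phi D j)"
    and a0: "cond_a0 P Z0 eps C" and a1: "cond_a1 P Z0 eps g C" and a2: "cond_a2 P Z0 eps g b C"
    and gi: "growth_integrable P Z0 eps g phi C"
  shows "(\<integral>\<omega>. growth C n \<omega> \<partial>P) \<le> prop_growth P eps g phi D n"
proof (rule expected_growth_le_prop_growth[OF i2 int a0 a1 a2 gi], rule AE_I2)
  fix j \<omega>
  show "((\<lambda>k. phi (eps j \<omega>) k * p (eps j \<omega>) k *
      (factor C j \<omega> k / (1 + D (eps j \<omega>) \<bullet> g (eps j \<omega>) k) - 1)) has_sum 0) UNIV"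
    by (rule cond_i3A_optimality[OF i2 i3A, where v = "(1 / Z C j \<omega>) *\<^sub>R C j \<omega>"])
      (simp add: factor_def)
qed

end

section \<open>Growth-optimal investment\<close>

theorem theorem3p1:
  fixes P :: "'w measure"
    and Z0 :: "'w \<Rightarrow> real"
    and eps :: "nat \<Rightarrow> 'w \<Rightarrow> 'm :: countable"
    and p :: "'m \<Rightarrow> 'm \<Rightarrow> real"
    and g :: "'m \<Rightarrow> 'm \<Rightarrow> real ^ 'k"
    and phi :: "'m \<Rightarrow> 'm \<Rightarrow> real"
    and b :: real
  assumes market: "markov_market P Z0 eps p g phi b"
  shows
    "\<comment> \<open>(a)\<close>
     (\<forall>q C. calibrating P eps p phi q \<and>
        cond_a0 P Z0 eps C \<and> cond_a1 P Z0 eps g C \<and> cond_a2_all P Z0 eps g b C \<and>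
        cond_a3 P eps g phi q C \<and> growth_integrable P Z0 eps g phi C \<longrightarrow>
        supermartingale P (info P Z0 eps)
          (\<lambda>n \<omega>. log_growth Z0 eps g phi C n \<omega> - compensator eps p phi q n \<omega>) \<and>
        (\<forall>n\<ge>1. (\<integral>\<omega>. log_growth Z0 eps g phi C n \<omega> \<partial>P)
             \<le> (\<integral>\<omega>. compensator eps p phi q n \<omega> \<partial>P)))
     \<and>
     \<comment> \<open>(b), martingale property versus equality of expectations\<close>
     (\<forall>q C. calibrating P eps p phi q \<and>
        cond_a0 P Z0 eps C \<and> cond_a1 P Z0 eps g C \<and> cond_a2_all P Z0 eps g b C \<and>
        cond_a3 P eps g phi q C \<and> growth_integrable P Z0 eps g phi C \<longrightarrow>
        (martingale P (info P Z0 eps)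
           (\<lambda>n \<omega>. log_growth Z0 eps g phi C n \<omega> - compensator eps p phi q n \<omega>)
         \<longleftrightarrow>
         (\<forall>n\<ge>1. (\<integral>\<omega>. log_growth Z0 eps g phi C n \<omega> \<partial>P)
              = (\<Sum>j=1..n. \<integral>\<omega>. alpha p phi q (j - 1) (eps (j - 1) \<omega>) \<partial>P))))
     \<and>
     \<comment> \<open>(b), sufficiency of (i) and (ii)\<close>
     (\<forall>q C D. calibrating P eps p phi q \<and>
        cond_a0 P Z0 eps C \<and> growth_integrable P Z0 eps g phi C \<and>
        (\<forall>i. cond_i1 (D i) \<and> cond_i2 g b i (D i) \<and> cond_i3 p g phi i (D i)) \<and>
        cond_i4 p g q D \<and> cond_ii P Z0 eps g D C \<longrightarrow>
        cond_a1 P Z0 eps g C \<and> cond_a2_all P Z0 eps g b C \<and> cond_a3 P eps g phi q C \<and>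
        martingale P (info P Z0 eps)
          (\<lambda>n \<omega>. log_growth Z0 eps g phi C n \<omega> - compensator eps p phi q n \<omega>))
     \<and>
     \<comment> \<open>(b), equivalence with (i) and (ii), all (i, k) and all components being identifiable\<close>
     (\<forall>q C. calibrating P eps p phi q \<and>
        (\<forall>j. q j = q 0) \<and>
        (\<forall>i k. phi i k > 0) \<and>
        (\<forall>i. \<exists>j. measure P {\<omega> \<in> space P. eps j \<omega> = i} > 0) \<and>
        (\<forall>i. nondegenerate p g phi i) \<and>
        cond_a0 P Z0 eps C \<and> growth_integrable P Z0 eps g phi C \<longrightarrow>
        (cond_a1 P Z0 eps g C \<and> cond_a2_all P Z0 eps g b C \<and> cond_a3 P eps g phi q C \<and>
         martingale P (info P Z0 eps)
           (\<lambda>n \<omega>. log_growth Z0 eps g phi C n \<omega> - compensator eps p phi q n \<omega>)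
         \<longleftrightarrow>
         (\<exists>D. (\<forall>i. cond_i1 (D i) \<and> cond_i2 g b i (D i) \<and> cond_i3 p g phi i (D i)) \<and>
              cond_i4 p g q D \<and> cond_ii P Z0 eps g D C)))
     \<and>
     \<comment> \<open>(b), equivalence without these restrictions: (i) and (ii) as far as they are identifiable\<close>
     (\<forall>q C. calibrating P eps p phi q \<and>
        cond_a0 P Z0 eps C \<and> cond_a1 P Z0 eps g C \<and> cond_a2_all P Z0 eps g b C \<and>
        cond_a3 P eps g phi q C \<and> growth_integrable P Z0 eps g phi C \<longrightarrow>
        (martingale P (info P Z0 eps)
           (\<lambda>n \<omega>. log_growth Z0 eps g phi C n \<omega> - compensator eps p phi q n \<omega>)
         \<longleftrightarrow>
         (\<exists>D. (\<forall>j i. measure P {\<omega> \<in> space P. eps j \<omega> = i} > 0 \<longrightarrow>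
                cond_i1 (D j i) \<and> cond_i2 g b i (D j i) \<and> cond_i3 p g phi i (D j i) \<and>
                (\<forall>k. phi i k > 0 \<longrightarrow> q (Suc j) i k = p i k / (1 + D j i \<bullet> g i k))) \<and>
              (\<forall>j. AE \<omega> in P. \<forall>k. phi (eps j \<omega>) k > 0 \<longrightarrow>
                C j \<omega> \<bullet> g (eps j \<omega>) k =
                  (D j (eps j \<omega>) \<bullet> g (eps j \<omega>) k) * capital Z0 eps g C j \<omega>))))
     \<and>
     \<comment> \<open>(c)\<close>
     (\<forall>n\<ge>1. \<forall>Dopt. optimizer P eps p g phi b n Dopt \<longrightarrow>
        (\<forall>q C D. feasible P eps p g phi b D \<and> cond_i4 p g q D \<and>
           cond_a0 P Z0 eps C \<and> cond_a1 P Z0 eps g C \<and> cond_a2 P Z0 eps g b C \<and>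
           cond_a3 P eps g phi q C \<and> growth_integrable P Z0 eps g phi C \<longrightarrow>
           (\<integral>\<omega>. log_growth Z0 eps g phi C n \<omega> \<partial>P) \<le> prop_growth P eps g phi Dopt n) \<and>
        (\<exists>q C. cond_i4 p g q Dopt \<and> cond_qp p phi q \<and> cond_ii P Z0 eps g Dopt C \<and>
           cond_a0 P Z0 eps C \<and> cond_a1 P Z0 eps g C \<and> cond_a2 P Z0 eps g b C \<and>
           cond_a3 P eps g phi q C \<and> growth_integrable P Z0 eps g phi C \<and>
           (\<integral>\<omega>. log_growth Z0 eps g phi C n \<omega> \<partial>P) = prop_growth P eps g phi Dopt n))
     \<and>
     \<comment> \<open>(d)\<close>
     (\<forall>Dopt. (\<forall>i. cond_i1 (Dopt i) \<and> cond_i2 g b i (Dopt i) \<and> cond_i3A p g phi i (Dopt i)) \<longrightarrow>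
        (\<forall>D. (\<forall>i. cond_i1 (D i) \<and> cond_i2 g b i (D i) \<and> cond_i3A p g phi i (D i)) \<longrightarrow>
           (\<forall>i k. phi i k * p i k > 0 \<longrightarrow> D i \<bullet> g i k = Dopt i \<bullet> g i k) \<and>
           (\<forall>i. nondegenerate p g phi i \<longrightarrow> D i = Dopt i)) \<and>
        ((\<forall>j. integrable P (prop_increment eps g phi Dopt j)) \<longrightarrow>
           (\<forall>D. (\<forall>i. cond_i1 (D i) \<and> cond_i2 g b i (D i)) \<longrightarrow>
              (\<forall>j. integrable P (prop_increment eps g phi D j) \<longrightarrow>
                 beta P eps g phi D j \<le> beta P eps g phi Dopt j)) \<and>
           (\<exists>Copt. cond_ii P Z0 eps g Dopt Copt \<and>
              cond_a0 P Z0 eps Copt \<and> cond_a1 P Z0 eps g Copt \<and> cond_a2 P Z0 eps g b Copt \<and>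
              growth_integrable P Z0 eps g phi Copt \<and>
              (\<forall>n\<ge>1. (\<integral>\<omega>. log_growth Z0 eps g phi Copt n \<omega> \<partial>P) = prop_growth P eps g phi Dopt n) \<and>
              (\<forall>C. cond_a0 P Z0 eps C \<and> cond_a1 P Z0 eps g C \<and> cond_a2 P Z0 eps g b C \<and>
                 growth_integrable P Z0 eps g phi C \<longrightarrow>
                 (\<forall>n\<ge>1. (\<integral>\<omega>. log_growth Z0 eps g phi C n \<omega> \<partial>P)
                      \<le> (\<integral>\<omega>. log_growth Z0 eps g phi Copt n \<omega> \<partial>P))))))"
proof -
  interpret M: markov_market P Z0 eps p g phi b by (rule market)
  have strategy: "calibrated_strategy P Z0 eps p g phi b q C"
    if "calibrating P eps p phi q" "cond_a0 P Z0 eps C" "cond_a1 P Z0 eps g C"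
      "cond_a2_all P Z0 eps g b C" "cond_a3 P eps g phi q C" "growth_integrable P Z0 eps g phi C"
    for q C
    using that market by (intro calibrated_strategy.intro calibrated_strategy_axioms.intro)
  \<comment> \<open>Under (i) and (ii) the ratio of capitals is \<open>1 + D \<bullet> g = p / q\<close>, the case of equality.\<close>
  have sufficient: "cond_a1 P Z0 eps g C \<and> cond_a2_all P Z0 eps g b C \<and> cond_a3 P eps g phi q C \<and>
      martingale P (info P Z0 eps)
        (\<lambda>n \<omega>. log_growth Z0 eps g phi C n \<omega> - compensator eps p phi q n \<omega>)"
    if q: "calibrating P eps p phi q" and a0: "cond_a0 P Z0 eps C"
      and gi: "growth_integrable P Z0 eps g phi C"
      and D: "\<forall>i. cond_i1 (D i) \<and> cond_i2 g b i (D i) \<and> cond_i3 p g phi i (D i)"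
      and i4: "cond_i4 p g q D" and ii: "cond_ii P Z0 eps g D C" for q C D
  proof -
    from D have i1: "cond_i1 (D i)" and i2: "cond_i2 g b i (D i)" and i3: "cond_i3 p g phi i (D i)" for i
      by auto
    have a1: "cond_a1 P Z0 eps g C" by (rule M.proportional_cond_a1[OF ii i1 i2])
    have a2: "cond_a2_all P Z0 eps g b C" by (rule M.proportional_cond_a2_all[OF ii i2])
    have a3: "cond_a3 P eps g phi q C" by (rule M.proportional_cond_a3[OF ii i2 i3 i4])
    interpret S: calibrated_strategy P Z0 eps p g phi b q C
      by (rule strategy[OF q a0 a1 a2 a3 gi])
    have "AE \<omega> in P. \<forall>k. 0 < phi (eps n \<omega>) k \<longrightarrow>
        q (Suc n) (eps n \<omega>) k * M.factor C n \<omega> k = p (eps n \<omega>) k" for n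
      using M.proportional_strategy[OF ii i2, of n]
    proof eventually_elim
      case (elim \<omega>)
      show ?case
      proof (intro allI impI)
        fix k
        have "q (Suc n) (eps n \<omega>) k = p (eps n \<omega>) k / (1 + D (eps n \<omega>) \<bullet> g (eps n \<omega>) k)"
          using i4 by (simp add: cond_i4_def)
        then show "q (Suc n) (eps n \<omega>) k * M.factor C n \<omega> k = p (eps n \<omega>) k"
          using elim M.cond_i2_pos[OF i2, of "eps n \<omega>" k] by simp
      qed
    qed
    then show ?thesis using a1 a2 a3 S.martingale_iff_calibrated by simp
  qed
  show ?thesis
  proof ((intro conjI; intro allI impI; (elim conjE)?), goal_cases)
    case (1 q C)
    interpret S: calibrated_strategy P Z0 eps p g phi b q C by (rule strategy) fact+
    show ?case using S.compensated_supermartingale S.expected_growth_le by blast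
  next
    case (2 q C)
    interpret S: calibrated_strategy P Z0 eps p g phi b q C by (rule strategy) fact+
    show ?case by (rule S.martingale_iff_expectations)
  next
    case (3 q C D)
    show ?case by (rule sufficient) fact+
  next
    case prems: (4 q C)
    show ?case
    proof
      assume *: "cond_a1 P Z0 eps g C \<and> cond_a2_all P Z0 eps g b C \<and> cond_a3 P eps g phi q C \<and>
         martingale P (info P Z0 eps)
           (\<lambda>n \<omega>. log_growth Z0 eps g phi C n \<omega> - compensator eps p phi q n \<omega>)"
      interpret S: calibrated_strategy P Z0 eps p g phi b q C
        by (rule strategy) (use prems * in auto)
      show "\<exists>D. (\<forall>i. cond_i1 (D i) \<and> cond_i2 g b i (D i) \<and> cond_i3 p g phi i (D i)) \<and>
              cond_i4 p g q D \<and> cond_ii P Z0 eps g D C"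
        by (rule S.martingale_imp_proportional) (use prems * in auto)
    next
      assume "\<exists>D. (\<forall>i. cond_i1 (D i) \<and> cond_i2 g b i (D i) \<and> cond_i3 p g phi i (D i)) \<and>
              cond_i4 p g q D \<and> cond_ii P Z0 eps g D C"
      then show "cond_a1 P Z0 eps g C \<and> cond_a2_all P Z0 eps g b C \<and> cond_a3 P eps g phi q C \<and>
         martingale P (info P Z0 eps)
           (\<lambda>n \<omega>. log_growth Z0 eps g phi C n \<omega> - compensator eps p phi q n \<omega>)"
        by (elim exE conjE) (rule sufficient[OF prems(1,6,7)])
    qed
  next
    case (5 q C)
    interpret S: calibrated_strategy P Z0 eps p g phi b q C by (rule strategy) fact+
    show ?case by (rule S.martingale_iff_fractions)
  next
    case prems: (6 n Dopt)
    show ?case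
    proof (intro conjI allI impI; (elim conjE)?)
      fix q C D
      assume D: "feasible P eps p g phi b D" and "cond_i4 p g q D"
        "cond_a0 P Z0 eps C" "cond_a1 P Z0 eps g C" "cond_a2 P Z0 eps g b C"
        "cond_a3 P eps g phi q C" "growth_integrable P Z0 eps g phi C"
      then have "(\<integral>\<omega>. log_growth Z0 eps g phi C n \<omega> \<partial>P) \<le> prop_growth P eps g phi D n"
        by (rule M.calibrated_growth_le_prop_growth)
      also have "\<dots> \<le> prop_growth P eps g phi Dopt n"
        using prems(2) D by (simp add: optimizer_def)
      finally show "(\<integral>\<omega>. log_growth Z0 eps g phi C n \<omega> \<partial>P) \<le> prop_growth P eps g phi Dopt n" .
    next
      show "\<exists>q C. cond_i4 p g q Dopt \<and> cond_qp p phi q \<and> cond_ii P Z0 eps g Dopt C \<and>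
           cond_a0 P Z0 eps C \<and> cond_a1 P Z0 eps g C \<and> cond_a2 P Z0 eps g b C \<and>
           cond_a3 P eps g phi q C \<and> growth_integrable P Z0 eps g phi C \<and>
           (\<integral>\<omega>. log_growth Z0 eps g phi C n \<omega> \<partial>P) = prop_growth P eps g phi Dopt n"
        using prems(2) by (intro M.optimal_portfolio_exists) (simp add: optimizer_def)
    qed
  next
    case prems: (7 Dopt)
    then have i1: "cond_i1 (Dopt i)" and i2: "cond_i2 g b i (Dopt i)"
      and i3A: "cond_i3A p g phi i (Dopt i)" for i
      by auto
    show ?case
    proof (rule conjI, (intro allI impI)[1], rule_tac [2] impI)
      fix D
      assume D: "\<forall>i. cond_i1 (D i) \<and> cond_i2 g b i (D i) \<and> cond_i3A p g phi i (D i)"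
      have eq: "D i \<bullet> g i k = Dopt i \<bullet> g i k" if "0 < phi i k * p i k" for i k
        using D i2 i3A that by (intro M.cond_i3A_unique) auto
      moreover have "D i = Dopt i" if "nondegenerate p g phi i" for i
      proof -
        have "\<forall>k. phi i k * p i k > 0 \<longrightarrow> (D i - Dopt i) \<bullet> g i k = 0"
          using eq by (simp add: inner_diff_left)
        then have "D i - Dopt i = 0" using that unfolding nondegenerate_def by blast
        then show ?thesis by simp
      qed
      ultimately show "(\<forall>i k. phi i k * p i k > 0 \<longrightarrow> D i \<bullet> g i k = Dopt i \<bullet> g i k) \<and>
           (\<forall>i. nondegenerate p g phi i \<longrightarrow> D i = Dopt i)"
        by blast
    next
      assume "\<forall>j. integrable P (prop_increment eps g phi Dopt j)"
      then have int: "integrable P (prop_increment eps g phi Dopt j)" for j ..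
      have "beta P eps g phi D j \<le> beta P eps g phi Dopt j"
        if "\<forall>i. cond_i1 (D i) \<and> cond_i2 g b i (D i)" "integrable P (prop_increment eps g phi D j)" for D j
        using that by (intro M.cond_i3A_beta_maximal[OF i2 i3A int]) auto
      moreover obtain C where C: "cond_ii P Z0 eps g Dopt C" "cond_a0 P Z0 eps C"
          "growth_integrable P Z0 eps g phi C"
          "\<And>n. (\<integral>\<omega>. log_growth Z0 eps g phi C n \<omega> \<partial>P) = prop_growth P eps g phi Dopt n"
        by (rule M.proportional_strategy_exists[OF i1 i2 int]) (rule that)
      moreover have "cond_a1 P Z0 eps g C" by (rule M.proportional_cond_a1[OF C(1) i1 i2])
      moreover have "cond_a2 P Z0 eps g b C"
        by (rule M.cond_a2_all_imp_cond_a2[OF M.proportional_cond_a2_all[OF C(1) i2]])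
      moreover have "(\<integral>\<omega>. log_growth Z0 eps g phi C' n \<omega> \<partial>P) \<le> (\<integral>\<omega>. log_growth Z0 eps g phi C n \<omega> \<partial>P)"
        if "cond_a0 P Z0 eps C'" "cond_a1 P Z0 eps g C'" "cond_a2 P Z0 eps g b C'"
          "growth_integrable P Z0 eps g phi C'" for C' n
        unfolding C(4) by (rule M.cond_i3A_growth_maximal[OF i2 i3A int that])
      ultimately show "(\<forall>D. (\<forall>i. cond_i1 (D i) \<and> cond_i2 g b i (D i)) \<longrightarrow>
              (\<forall>j. integrable P (prop_increment eps g phi D j) \<longrightarrow>
                 beta P eps g phi D j \<le> beta P eps g phi Dopt j)) \<and>
           (\<exists>Copt. cond_ii P Z0 eps g Dopt Copt \<and>
              cond_a0 P Z0 eps Copt \<and> cond_a1 P Z0 eps g Copt \<and> cond_a2 P Z0 eps g b Copt \<and>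
              growth_integrable P Z0 eps g phi Copt \<and>
              (\<forall>n\<ge>1. (\<integral>\<omega>. log_growth Z0 eps g phi Copt n \<omega> \<partial>P) = prop_growth P eps g phi Dopt n) \<and>
              (\<forall>C. cond_a0 P Z0 eps C \<and> cond_a1 P Z0 eps g C \<and> cond_a2 P Z0 eps g b C \<and>
                 growth_integrable P Z0 eps g phi C \<longrightarrow>
                 (\<forall>n\<ge>1. (\<integral>\<omega>. log_growth Z0 eps g phi C n \<omega> \<partial>P)
                      \<le> (\<integral>\<omega>. log_growth Z0 eps g phi Copt n \<omega> \<partial>P))))"
        by blast
    qed
  qed
qed

end
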